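(* Let $\varepsilon>0$ and let $\Omega$ be a future complete domain in $\mathbf{R}^{1,n}$ with cosmological time function $\tau$. If $\partial\Omega$ is $\varepsilon$-stably acausal, then $$\frac{\varepsilon}{\sqrt{2+2(1+\varepsilon)^2}}\,\hat d_{\ln(\tau)}-c_\varepsilon\le\delta_\Omega\le 2\,\hat d_{\ln(\tau)},$$ where $c_\varepsilon=\frac{\varepsilon}{\sqrt{2+2(1+\varepsilon)^2}}\ln\left(\frac{(1+\varepsilon)^2+1}{(1+\varepsilon)^2-1}\right)$.
   Context: Minkowski space: $\mathbf{R}^{1,n}$ ($n\ge 1$) is $\mathbf{R}\times\mathbf{R}^n$ with coordinates $(t,p)$, flat metric $\mathbf{b}=-dt^2+dp_1^2+\dots+dp_n^2$ and time orientation $\partial_t$. A nonzero vector $v$ is lightlike if $\mathbf{b}(v,v)=0$, causal if $\mathbf{b}(v,v)\le 0$, and a causal vector is future if $\mathbf{b}(v,\partial_t)<0$; a future causal curve is a piecewise smooth curve with future causal velocity. Write $x\le y$ if $x=y$ or there is a future causal curve from $x$ to $y$; $J^-(x)=\{y:y\le x\}$. A domain is a nonempty, connected, proper open subset of $\mathbf{R}^{1,n}$. A domain $\Omega$ is future complete if every future causal curve of $\mathbf{R}^{1,n}$ starting in $\Omega$ is contained in $\Omega$. Cosmological time: for $x\le y$ let $\mathcal{T}(x,y)=\sqrt{|\mathbf{b}(y-x,y-x)|}$; $\tau(x)=\sup\{\mathcal{T}(y,x): y\in\Omega\cap J^-(x)\}$. Null distance: for a time function $T:\Omega\to\mathbf{R}$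 (continuous and strictly increasing along future causal curves), $\hat d_T(x,y)=\inf\sum_{k=1}^{m-1}|T(x_{k+1})-T(x_k)|$, the infimum over all finite sequences $x_1=x,\dots,x_m=y$ in $\Omega$ such that $x_k$ and $x_{k+1}$ are causally related for all $k$. Markowitz pseudodistance: let $I=(-1,1)$ and $\rho_I(s,t)=\left|\ln\frac{(s-1)(t+1)}{(s+1)(t-1)}\right|$. For a domain $\Omega$, a projectively parametrized lightlike geodesic of $\Omega$ is a curve $\gamma:I\to\Omega$, $\gamma(s)=x+h(s)v$, with $v$ lightlike and $h$ a (nonconstant) real homography without pole in $I$. Then $\delta_\Omega(x,y)=\inf\sum_{k=1}^m\rho_I(s_k,t_k)$, the infimum being over all finite families of such geodesics $\gamma_1,\dots,\gamma_m$ and points $s_k,t_k\in I$ with $\gamma_1(s_1)=x$, $\gamma_m(t_m)=y$, $\gamma_k(t_k)=\gamma_{k+1}(s_{k+1})$. Stable acausality: let $\mathbf{b}_\varepsilon=-(1+\varepsilon)^2dt^2+dp_1^2+\dots+dp_n^2$. A subset of $\mathbf{R}^{1,n}$ is $\varepsilon$-stably acausal if no two distinct points of it are causally related for $\mathbf{b}_\varepsilon$. *)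

theory Defs
  imports "HOL-Analysis.Analysis"
begin

type_synonym 'n minkowski = "real \<times> (real ^ 'n)"

text \<open>
  The flat Lorentzian form with light cones opened by \<open>\<epsilon>\<close>; \<open>lorentz_form 0\<close> is the
  Minkowski metric. The causal notions below take the form as a parameter \<open>B\<close>.
\<close>

definition lorentz_form :: "real \<Rightarrow> 'n::finite minkowski \<Rightarrow> 'n minkowski \<Rightarrow> real" where
  "lorentz_form \<epsilon> u v = - ((1 + \<epsilon>)\<^sup>2) * fst u * fst v + snd u \<bullet> snd v"

abbreviation minkowski_form :: "'n::finite minkowski \<Rightarrow> 'n minkowski \<Rightarrow> real" where
  "minkowski_form \<equiv> lorentz_form 0"

definition lightlike :: "'n::finite minkowski \<Rightarrow> bool" where
  "lightlike v \<longleftrightarrow> v \<noteq> 0 \<and> minkowski_form v v = 0"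

definition future_causal ::
    "('n::finite minkowski \<Rightarrow> 'n minkowski \<Rightarrow> real) \<Rightarrow> 'n minkowski \<Rightarrow> bool" where
  "future_causal B v \<longleftrightarrow> v \<noteq> 0 \<and> B v v \<le> 0 \<and> B v (1, 0) < 0"

text \<open>Smoothness on a closed interval, with one-sided derivatives of all orders at the ends:
  \<open>D k\<close> is the derivative of order \<open>k\<close>.\<close>

definition smooth_on_interval :: "real \<Rightarrow> real \<Rightarrow> (real \<Rightarrow> 'a::real_normed_vector) \<Rightarrow> bool" where
  "smooth_on_interval a b g \<longleftrightarrow>
    (\<exists>D :: nat \<Rightarrow> real \<Rightarrow> 'a.
      (\<forall>s\<in>{a..b}. D 0 s = g s) \<and>
      (\<forall>k. \<forall>s\<in>{a..b}. (D k has_vector_derivative D (Suc k) s) (at s within {a..b})))"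

text \<open>Curves are parametrized by \<open>{0..1}\<close>, as for \<^const>\<open>path\<close>. At a break point both
  one-sided velocities are required to be future causal.\<close>

definition future_causal_curve ::
    "('n::finite minkowski \<Rightarrow> 'n minkowski \<Rightarrow> real) \<Rightarrow> (real \<Rightarrow> 'n minkowski) \<Rightarrow> bool" where
  "future_causal_curve B g \<longleftrightarrow>
    path g \<and>
    (\<exists>(m::nat) (t :: nat \<Rightarrow> real).
      t 0 = 0 \<and> t m = 1 \<and>
      (\<forall>i<m. t i < t (Suc i) \<and>
        smooth_on_interval (t i) (t (Suc i)) g \<and>
        (\<forall>s\<in>{t i..t (Suc i)}.
          future_causal B (vector_derivative g (at s within {t i..t (Suc i)})))))"

definition causal_le ::
    "('n::finite minkowski \<Rightarrow> 'n minkowski \<Rightarrow> real) \<Rightarrow> 'n minkowski \<Rightarrow> 'n minkowski \<Rightarrow> bool" where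
  "causal_le B x y \<longleftrightarrow>
    x = y \<or> (\<exists>g. future_causal_curve B g \<and> pathstart g = x \<and> pathfinish g = y)"

definition causally_related ::
    "('n::finite minkowski \<Rightarrow> 'n minkowski \<Rightarrow> real) \<Rightarrow> 'n minkowski \<Rightarrow> 'n minkowski \<Rightarrow> bool" where
  "causally_related B x y \<longleftrightarrow> causal_le B x y \<or> causal_le B y x"

definition causal_past :: "'n::finite minkowski \<Rightarrow> 'n minkowski set" where
  "causal_past x = {y. causal_le minkowski_form y x}"

definition domain :: "'n::finite minkowski set \<Rightarrow> bool" where
  "domain \<Omega> \<longleftrightarrow> \<Omega> \<noteq> {} \<and> connected \<Omega> \<and> \<Omega> \<noteq> UNIV \<and> open \<Omega>"

definition future_complete :: "'n::finite minkowski set \<Rightarrow> bool" where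
  "future_complete \<Omega> \<longleftrightarrow>
    (\<forall>g. future_causal_curve minkowski_form g \<and> pathstart g \<in> \<Omega> \<longrightarrow> path_image g \<subseteq> \<Omega>)"

definition stably_acausal :: "real \<Rightarrow> 'n::finite minkowski set \<Rightarrow> bool" where
  "stably_acausal \<epsilon> S \<longleftrightarrow>
    (\<forall>x\<in>S. \<forall>y\<in>S. x \<noteq> y \<longrightarrow> \<not> causally_related (lorentz_form \<epsilon>) x y)"

definition lorentz_dist :: "'n::finite minkowski \<Rightarrow> 'n minkowski \<Rightarrow> real" where
  "lorentz_dist x y = sqrt \<bar>minkowski_form (y - x) (y - x)\<bar>"

text \<open>
  The supremum below and the two infima further down are taken in the reals. The set in the
  supremum contains \<open>0\<close> (take \<open>y = x\<close>), but is bounded above only under suitable assumptions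
  on \<open>\<Omega>\<close>, for instance when \<open>\<Omega>\<close> is a future complete domain whose boundary is
  stably acausal. The sets in the infima are bounded below by \<open>0\<close>, and are nonempty for
  points of such a domain.
\<close>

definition cosmological_time :: "'n::finite minkowski set \<Rightarrow> 'n minkowski \<Rightarrow> real" where
  "cosmological_time \<Omega> x = Sup {lorentz_dist y x | y. y \<in> \<Omega> \<inter> causal_past x}"

definition null_distance ::
    "'n::finite minkowski set \<Rightarrow> ('n minkowski \<Rightarrow> real) \<Rightarrow> 'n minkowski \<Rightarrow> 'n minkowski \<Rightarrow> real" where
  "null_distance \<Omega> T x y =
    Inf {(\<Sum>k\<in>{1..<m}. \<bar>T (p (k + 1)) - T (p k)\<bar>) | (m::nat) (p :: nat \<Rightarrow> 'n minkowski).
      1 \<le> m \<and> p 1 = x \<and> p m = y \<and> (\<forall>k\<in>{1..m}. p k \<in> \<Omega>) \<and>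
      (\<forall>k\<in>{1..<m}. causally_related minkowski_form (p k) (p (k + 1)))}"

abbreviation I :: "real set" where
  "I \<equiv> {-1<..<1}"

definition rho_I :: "real \<Rightarrow> real \<Rightarrow> real" where
  "rho_I s t = \<bar>ln (((s - 1) * (t + 1)) / ((s + 1) * (t - 1)))\<bar>"

text \<open>Nonconstant real homographies \<open>s \<mapsto> (a s + b) / (c s + d)\<close> without pole in \<open>S\<close>.\<close>

definition homography_on :: "real set \<Rightarrow> (real \<Rightarrow> real) \<Rightarrow> bool" where
  "homography_on S h \<longleftrightarrow>
    (\<exists>a b c d. a * d - b * c \<noteq> 0 \<and>
      (\<forall>s\<in>S. c * s + d \<noteq> 0 \<and> h s = (a * s + b) / (c * s + d)))"

definition projective_lightlike_geodesic ::
    "'n::finite minkowski set \<Rightarrow> (real \<Rightarrow> 'n minkowski) \<Rightarrow> bool" where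
  "projective_lightlike_geodesic \<Omega> \<gamma> \<longleftrightarrow>
    \<gamma> ` I \<subseteq> \<Omega> \<and>
    (\<exists>x v h. lightlike v \<and> homography_on I h \<and> (\<forall>s\<in>I. \<gamma> s = x + h s *\<^sub>R v))"

definition markowitz_dist ::
    "'n::finite minkowski set \<Rightarrow> 'n minkowski \<Rightarrow> 'n minkowski \<Rightarrow> real" where
  "markowitz_dist \<Omega> x y =
    Inf {(\<Sum>k\<in>{1..m}. rho_I (s k) (t k)) |
        (m::nat) (\<gamma> :: nat \<Rightarrow> real \<Rightarrow> 'n minkowski) (s :: nat \<Rightarrow> real) (t :: nat \<Rightarrow> real).
      1 \<le> m \<and>
      (\<forall>k\<in>{1..m}. projective_lightlike_geodesic \<Omega> (\<gamma> k) \<and> s k \<in> I \<and> t k \<in> I) \<and>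
      \<gamma> 1 (s 1) = x \<and> \<gamma> m (t m) = y \<and>
      (\<forall>k\<in>{1..<m}. \<gamma> k (t k) = \<gamma> (k + 1) (s (k + 1)))}"

definition c_eps :: "real \<Rightarrow> real" where
  "c_eps \<epsilon> = \<epsilon> / sqrt (2 + 2 * (1 + \<epsilon>)\<^sup>2) * ln (((1 + \<epsilon>)\<^sup>2 + 1) / ((1 + \<epsilon>)\<^sup>2 - 1))"

end

theory Submission
  imports Defs "HOL-Real_Asymp.Real_Asymp"
begin

text \<open>
  Let \<open>v = (1, u)\<close> with \<open>u\<close> a unit vector. Along a null ray \<open>q + a v\<close> that enters \<open>\<Omega>\<close> at \<open>a = 0\<close>,
  the function \<open>\<tau>\<^sup>2\<close> is a supremum of affine functions of \<open>a\<close> that are nonpositive at \<open>0\<close>, so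
  \<open>\<tau>\<close> grows at least like \<open>sqrt a\<close>. As \<open>ln (b / a)\<close> is the length for \<open>\<rho>\<^sub>I\<close> of a segment of the
  ray, and causal vectors are sums of two null ones, this gives the upper bound.

  For the lower bound, the frontier is the graph of a \<open>1/(1 + \<epsilon>)\<close>-Lipschitz function. The timelike
  vectors that nearly realize \<open>\<tau>\<close> can therefore be taken in a narrow cone, which bounds the derivative
  of \<open>\<tau>\<close> along \<open>v\<close> by \<open>\<kappa>\<close>, where \<open>\<kappa>\<^sup>2 = (2 + \<epsilon>) / \<epsilon>\<close>; moreover \<open>\<tau> (q + a v) \<ge> a / \<kappa>\<close>. Hence
  \<open>ln \<tau>\<close> grows by at most \<open>\<kappa>\<^sup>2 ln (b / a)\<close>, so that \<open>\<epsilon> / (2 + \<epsilon>)\<close> times the null distance is a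
  lower bound for \<open>\<delta>\<close>. This is already stronger than the claim: \<open>2 + \<epsilon> \<le> sqrt (2 + 2 (1 + \<epsilon>)\<^sup>2)\<close>
  and the additive constant is nonnegative.
\<close>

section \<open>Causal relations as cone conditions\<close>

lemma future_causal_lorentz_iff:
  assumes "0 \<le> \<epsilon>"
  shows "future_causal (lorentz_form \<epsilon>) v \<longleftrightarrow> v \<noteq> 0 \<and> norm (snd v) \<le> (1 + \<epsilon>) * fst v"
proof -
  have "lorentz_form \<epsilon> v (1, 0) < 0 \<longleftrightarrow> 0 < fst v"
    using assms by (simp add: lorentz_form_def zero_less_mult_iff)
  moreover have "lorentz_form \<epsilon> v v \<le> 0 \<longleftrightarrow> norm (snd v) \<le> \<bar>(1 + \<epsilon>) * fst v\<bar>"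
    using abs_le_square_iff[of "norm (snd v)" "(1 + \<epsilon>) * fst v"]
    by (simp add: lorentz_form_def power2_norm_eq_inner[symmetric] power_mult_distrib)
      (simp add: power2_eq_square ac_simps power2_norm_eq_inner[symmetric])
  moreover have "0 < fst v" if "v \<noteq> 0" "norm (snd v) \<le> (1 + \<epsilon>) * fst v"
  proof -
    have "0 \<le> fst v"
      using assms order_trans[OF norm_ge_zero that(2)] by (simp add: zero_le_mult_iff)
    moreover have "fst v \<noteq> 0" using that by (auto simp: prod_eq_iff)
    ultimately show ?thesis by simp
  qed
  ultimately show ?thesis
    using assms unfolding future_causal_def by (auto simp: abs_of_nonneg)
qed

lemma smooth_on_interval_affine: "smooth_on_interval a b (\<lambda>s. x + s *\<^sub>R d)"
  unfolding smooth_on_interval_def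
proof (intro exI conjI ballI allI)
  fix k s
  \<comment> \<open>The derivative sequence is fixed by this goal: the affine map at order 0, the
    constant \<open>d\<close> at order 1, zero at every higher order.\<close>
  show "((case k of 0 \<Rightarrow> \<lambda>s. x + s *\<^sub>R d | Suc j \<Rightarrow> \<lambda>s. if j = 0 then d else 0)
      has_vector_derivative
      (case Suc k of 0 \<Rightarrow> \<lambda>s. x + s *\<^sub>R d | Suc j \<Rightarrow> \<lambda>s. if j = 0 then d else 0) s)
      (at s within {a..b})"
    by (cases k) (auto intro!: derivative_eq_intros)
qed auto

lemma future_causal_curve_segment:
  assumes "future_causal B d"
  shows "future_causal_curve B (\<lambda>s. x + s *\<^sub>R d)"
  unfolding future_causal_curve_def
proof (intro conjI exI)
  show "path (\<lambda>s. x + s *\<^sub>R d)"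
    unfolding path_def by (intro continuous_intros)
  have "vector_derivative (\<lambda>s. x + s *\<^sub>R d) (at s within {0..1}) = d" if "s \<in> {0..1}" for s :: real
    using that by (intro vector_derivative_within_cbox[of 0 1, simplified])
      (auto intro!: derivative_eq_intros)
  then show "\<forall>i<1::nat. real i < real (Suc i) \<and>
      smooth_on_interval (real i) (real (Suc i)) (\<lambda>s. x + s *\<^sub>R d) \<and>
      (\<forall>s\<in>{real i..real (Suc i)}. future_causal B
        (vector_derivative (\<lambda>s. x + s *\<^sub>R d) (at s within {real i..real (Suc i)})))"
    using assms by (simp add: smooth_on_interval_affine)
qed auto

lemma causal_le_lorentzI:
  assumes "0 \<le> \<epsilon>" "norm (snd (y - x)) \<le> (1 + \<epsilon>) * fst (y - x)"
  shows "causal_le (lorentz_form \<epsilon>) x y"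
proof (cases "x = y")
  case False
  then have "future_causal (lorentz_form \<epsilon>) (y - x)"
    using assms by (simp add: future_causal_lorentz_iff)
  from future_causal_curve_segment[OF this, of x] show ?thesis
    unfolding causal_le_def
    by (intro disjI2 exI[of _ "\<lambda>s. x + s *\<^sub>R (y - x)"]) (auto simp: pathstart_def pathfinish_def)
qed (simp add: causal_le_def)

lemma unit_vector_along:
  fixes p :: "real ^ 'n::finite"
  obtains u where "norm u = 1" "p = norm p *\<^sub>R u"
proof (cases "p = 0")
  case True
  obtain u :: "real ^ 'n" where "norm u = 1" using vector_choose_size[of 1] by auto
  then show ?thesis using True that by simp
next
  case False
  then show ?thesis using that[of "sgn p"] by (simp add: norm_sgn sgn_div_norm)
qed

text \<open>The cone condition on velocities integrates by duality: for the unit vector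
  \<open>e\<close> along the spatial increment, \<open>fst - e \<bullet> snd\<close> has nonnegative
  derivative by Cauchy-Schwarz, and its total increment is exactly the difference of the two
  sides.\<close>

lemma smooth_causal_piece:
  fixes g :: "real \<Rightarrow> 'n::finite minkowski"
  assumes "a < b" "smooth_on_interval a b g"
    and "\<And>s. s \<in> {a..b} \<Longrightarrow> future_causal minkowski_form (vector_derivative g (at s within {a..b}))"
  shows "norm (snd (g b - g a)) \<le> fst (g b - g a)"
proof -
  obtain D where D0: "\<And>s. s \<in> {a..b} \<Longrightarrow> D 0 s = g s"
    and D: "\<And>k s. s \<in> {a..b} \<Longrightarrow> (D k has_vector_derivative D (Suc k) s) (at s within {a..b})"
    using assms(2) unfolding smooth_on_interval_def by blast
  have g': "(g has_vector_derivative D 1 s) (at s within {a..b})" if "s \<in> {a..b}" for s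
    using has_vector_derivative_transform[OF that _ D[OF that, of 0], of g] D0 by simp
  have cone: "norm (snd (D 1 s)) \<le> fst (D 1 s)" if "s \<in> {a..b}" for s
    using assms(3)[OF that] vector_derivative_within_cbox[unfolded box_real, OF \<open>a < b\<close> that g'[OF that]]
    by (simp add: future_causal_lorentz_iff)
  obtain e where e: "norm e = 1" "snd (g b - g a) = norm (snd (g b - g a)) *\<^sub>R e"
    by (rule unit_vector_along)
  define \<phi> where "\<phi> s = fst (g s) - e \<bullet> snd (g s)" for s
  have \<phi>': "(\<phi> has_vector_derivative (fst (D 1 s) - e \<bullet> snd (D 1 s))) (at s within {a..b})"
    if "s \<in> {a..b}" for s
  proof -
    have bl: "bounded_linear (\<lambda>w :: 'n minkowski. fst w - e \<bullet> snd w)"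
      by (intro bounded_linear_intros)
    show ?thesis
      using bounded_linear.has_vector_derivative[OF bl g'[OF that]] by (simp add: \<phi>_def[abs_def])
  qed
  have "\<phi> a \<le> \<phi> b"
  proof (rule DERIV_nonneg_imp_increasing_open[where f = \<phi>])
    show "a \<le> b" using \<open>a < b\<close> by simp
    show "continuous_on {a..b} \<phi>"
      using \<phi>' has_vector_derivative_continuous continuous_on_eq_continuous_within by blast
    fix s assume s: "a < s" "s < b"
    have "e \<bullet> snd (D 1 s) \<le> norm e * norm (snd (D 1 s))" by (rule norm_cauchy_schwarz)
    also have "\<dots> \<le> fst (D 1 s)" using cone[of s] s e(1) by simp
    finally have "0 \<le> fst (D 1 s) - e \<bullet> snd (D 1 s)" by simp
    moreover have "(\<phi> has_real_derivative (fst (D 1 s) - e \<bullet> snd (D 1 s))) (at s)"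
      using \<phi>'[of s] s at_within_Icc_at[of a s b]
      by (simp add: has_real_derivative_iff_has_vector_derivative)
    ultimately show "\<exists>y. (\<phi> has_real_derivative y) (at s) \<and> 0 \<le> y" by blast
  qed
  moreover have "e \<bullet> snd (g b - g a) = norm (snd (g b - g a))"
    by (subst e(2)) (simp add: e(1) dot_square_norm)
  ultimately show ?thesis by (simp add: \<phi>_def inner_diff_right)
qed

text \<open>A straight segment realizes every vector of the cone. Conversely the increments of the
  smooth pieces of a curve lie in the cone, which is closed under addition.\<close>

lemma causal_le_minkowski_iff:
  "causal_le minkowski_form x y \<longleftrightarrow> norm (snd (y - x)) \<le> fst (y - x)"
proof
  assume "norm (snd (y - x)) \<le> fst (y - x)"
  then show "causal_le minkowski_form x y" using causal_le_lorentzI[of 0 y x] by simp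
next
  assume "causal_le minkowski_form x y"
  then consider "x = y" | g where "future_causal_curve minkowski_form g" "pathstart g = x" "pathfinish g = y"
    unfolding causal_le_def by blast
  then show "norm (snd (y - x)) \<le> fst (y - x)"
  proof cases
    case (2 g)
    then obtain m t where t: "t 0 = 0" "t m = 1"
      and piece: "\<And>i. i < m \<Longrightarrow> t i < t (Suc i) \<and> smooth_on_interval (t i) (t (Suc i)) g \<and>
        (\<forall>s\<in>{t i..t (Suc i)}. future_causal minkowski_form
          (vector_derivative g (at s within {t i..t (Suc i)})))"
      unfolding future_causal_curve_def by blast
    have "norm (snd (g (t i) - g (t 0))) \<le> fst (g (t i) - g (t 0))" if "i \<le> m" for i
      using that
    proof (induction i)
      case (Suc i)
      have "norm (snd (g (t (Suc i)) - g (t i))) \<le> fst (g (t (Suc i)) - g (t i))"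
        using smooth_causal_piece[of "t i" "t (Suc i)" g] piece[of i] Suc.prems by auto
      then show ?case
        using Suc norm_triangle_ineq[of "snd (g (t (Suc i)) - g (t i))" "snd (g (t i) - g (t 0))"]
        by simp
    qed simp
    from this[of m] show ?thesis using 2 t by (auto simp: pathstart_def pathfinish_def)
  qed simp
qed

section \<open>The interval along null directions\<close>

text \<open>The Minkowski form with reversed sign, so that causal vectors have nonnegative values
  and the square root is the Lorentzian length.\<close>

definition interval_sq :: "'n::finite minkowski \<Rightarrow> real" where
  "interval_sq w = (fst w)\<^sup>2 - (norm (snd w))\<^sup>2"

text \<open>The coefficient of \<open>a\<^sup>2\<close> is the interval of the null vector
  \<open>(1, u)\<close>, which is zero. That the interval is affine along null rays underlies every
  estimate of \<tau> below.\<close>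

lemma interval_sq_add_null:
  assumes "norm u = 1"
  shows "interval_sq (w + a *\<^sub>R (1, u)) = interval_sq w + 2 * a * (fst w - u \<bullet> snd w)"
proof -
  have "u \<bullet> u = 1" using assms by (simp add: dot_square_norm)
  then show ?thesis
    unfolding interval_sq_def power2_norm_eq_inner
    by (simp add: inner_add_left inner_add_right inner_commute power2_eq_square algebra_simps)
qed

lemma causal_interval_sq_nonneg:
  assumes "norm (snd w) \<le> fst w"
  shows "0 \<le> interval_sq w"
  using assms power_mono[of "norm (snd w)" "fst w" 2] by (simp add: interval_sq_def)

text \<open>Positive interval makes \<open>w\<close> timelike, either future or past. If it were
  past, the triangle inequality would prevent the future null translate
  \<open>w + a *\<^sub>R (1, u)\<close> from being future causal.\<close>

lemma timelike_before_null_translate: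
  assumes "norm u = 1" "0 \<le> a" "0 < interval_sq w"
    and "norm (snd (w + a *\<^sub>R (1, u))) \<le> fst (w + a *\<^sub>R (1, u))"
  shows "norm (snd w) \<le> fst w"
proof (rule ccontr)
  assume "\<not> ?thesis"
  moreover have "norm (snd w) < \<bar>fst w\<bar>"
    using assms(3) power2_less_imp_less[of "norm (snd w)" "\<bar>fst w\<bar>"] by (simp add: interval_sq_def)
  ultimately have "fst w + norm (snd w) < 0" by linarith
  moreover have "a \<le> norm (snd w + a *\<^sub>R u) + norm (snd w)"
    using norm_triangle_ineq4[of "snd w + a *\<^sub>R u" "snd w"] assms(1,2) by simp
  ultimately show False using assms(4) by simp
qed

section \<open>Estimates for the logarithm\<close>

text \<open>Both sides vanish at 1 and their difference has derivative
  \<open>(1 - 1 / y)\<^sup>2 / 2\<close>. For \<open>x = Y / X\<close> the right side is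
  \<open>(Y\<^sup>2 - X\<^sup>2) / (2 * X * Y)\<close>, so an increment of squares that is linear in
  \<open>Y\<close> can be inserted without loss.\<close>

lemma ln_le_half_diff_inverse:
  fixes x :: real
  assumes "1 \<le> x"
  shows "ln x \<le> (x - 1 / x) / 2"
proof -
  define f where "f y = (y - 1 / y) / 2 - ln y" for y :: real
  have "f 1 \<le> f x"
  proof (rule DERIV_nonneg_imp_nondecreasing[OF assms])
    fix y :: real assume y: "1 \<le> y" "y \<le> x"
    have "(f has_real_derivative (1 + 1 / y\<^sup>2) / 2 - 1 / y) (at y)"
      unfolding f_def using y
      by (auto intro!: derivative_eq_intros simp: power2_eq_square field_simps)
    moreover have "(1 + 1 / y\<^sup>2) / 2 - 1 / y = (1 - 1 / y)\<^sup>2 / 2"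
      using y by (simp add: power2_eq_square field_simps)
    ultimately show "\<exists>d. (f has_real_derivative d) (at y) \<and> 0 \<le> d" by force
  qed
  then show ?thesis by (simp add: f_def)
qed

text \<open>Subdividing \<open>[a, b]\<close> geometrically removes the second order loss in the hypothesis.\<close>

lemma ln_ratio_bound_of_infinitesimal:
  fixes \<phi> :: "real \<Rightarrow> real"
  assumes step: "\<And>a b. 0 < a \<Longrightarrow> a < b \<Longrightarrow> \<phi> b - \<phi> a \<le> R * (b / a - 1)"
    and "0 < a" "a < b"
  shows "\<phi> b - \<phi> a \<le> R * ln (b / a)"
proof -
  have l: "0 < ln (b / a)" using assms by simp
  have "\<phi> b - \<phi> a \<le> R * (real N * (exp (ln (b / a) / real N) - 1))" if "0 < N" for N
  proof -
    define \<mu> where "\<mu> = exp (ln (b / a) / real N)"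
    have "1 < \<mu>" using l that by (simp add: \<mu>_def)
    have "\<phi> (a * \<mu> ^ k) - \<phi> a \<le> real k * (R * (\<mu> - 1))" for k
    proof (induction k)
      case (Suc k)
      have "0 < a * \<mu> ^ k" using \<open>1 < \<mu>\<close> \<open>0 < a\<close> by simp
      then have "\<phi> (a * \<mu> ^ Suc k) - \<phi> (a * \<mu> ^ k) \<le> R * (\<mu> - 1)"
        using step[of "a * \<mu> ^ k" "a * \<mu> ^ Suc k"] \<open>1 < \<mu>\<close> \<open>0 < a\<close> by simp
      then show ?case using Suc by (simp add: algebra_simps)
    qed simp
    from this[of N] show ?thesis
      using that assms by (simp add: \<mu>_def exp_of_nat_mult[symmetric] mult.left_commute)
  qed
  then have "\<forall>\<^sub>F N in sequentially. \<phi> b - \<phi> a \<le> R * (real N * (exp (ln (b / a) / real N) - 1))"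
    by (intro eventually_mono[OF eventually_gt_at_top[of 0]])
  moreover have "(\<lambda>N. real N * (exp (l / real N) - 1)) \<longlonglongrightarrow> l" for l :: real
    by real_asymp
  ultimately show ?thesis
    by (intro tendsto_lowerbound[OF tendsto_mult_left]) auto
qed

section \<open>The metric of the interval and projective parametrizations\<close>

text \<open>The coordinate \<open>ln ((1 + s) / (1 - s))\<close> turns \<open>rho_I\<close> into the
  usual distance of the real line.\<close>

lemma rho_I_eq:
  assumes "s \<in> I" "t \<in> I"
  shows "rho_I s t = \<bar>ln ((1 + t) / (1 - t)) - ln ((1 + s) / (1 - s))\<bar>"
proof -
  have "((s - 1) * (t + 1)) / ((s + 1) * (t - 1)) = ((1 + t) / (1 - t)) / ((1 + s) / (1 - s))"
    using assms by (simp add: divide_simps) (simp add: algebra_simps)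
  also have "ln \<dots> = ln ((1 + t) / (1 - t)) - ln ((1 + s) / (1 - s))"
    using assms by (subst ln_div) auto
  finally show ?thesis by (simp add: rho_I_def)
qed

lemma rho_I_commute: "s \<in> I \<Longrightarrow> t \<in> I \<Longrightarrow> rho_I s t = rho_I t s"
  by (simp add: rho_I_eq abs_minus_commute)

lemma rho_I_nonneg: "0 \<le> rho_I s t"
  by (simp add: rho_I_def)

lemma rho_I_uminus:
  assumes "s \<in> I" "t \<in> I"
  shows "rho_I (- s) (- t) = rho_I s t"
proof -
  have "ln ((1 + - x) / (1 - - x)) = - ln ((1 + x) / (1 - x))" if "x \<in> I" for x
    using that by (simp add: ln_div)
  then show ?thesis using assms by (simp add: rho_I_eq)
qed

text \<open>The time component of \<open>v\<close> is absorbed into the homography, the sign of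
  \<open>d\<close> makes the denominator positive, and the reflection \<open>\<eta>\<close> of the
  parameter makes the determinant positive. Every geodesic thus becomes a future directed one up to
  reflection.\<close>

lemma projective_lightlike_geodesic_normal_form:
  assumes "projective_lightlike_geodesic \<Omega> \<gamma>"
  obtains x u a b c d \<eta> where "norm u = 1" "0 < a * d - b * c" "\<eta> = 1 \<or> \<eta> = (-1::real)"
    "\<And>s. s \<in> I \<Longrightarrow> 0 < c * s + d"
    "\<And>s. s \<in> I \<Longrightarrow> \<gamma> s = x + ((a * (\<eta> * s) + b) / (c * (\<eta> * s) + d)) *\<^sub>R (1, u)"
proof -
  obtain x v h where v: "lightlike v" and h: "homography_on I h"
    and \<gamma>: "\<And>s. s \<in> I \<Longrightarrow> \<gamma> s = x + h s *\<^sub>R v"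
    using assms unfolding projective_lightlike_geodesic_def by blast
  obtain a b c d where det: "a * d - b * c \<noteq> 0"
    and nz: "\<And>s. s \<in> I \<Longrightarrow> c * s + d \<noteq> 0"
    and hs: "\<And>s. s \<in> I \<Longrightarrow> h s = (a * s + b) / (c * s + d)"
    using h unfolding homography_on_def by blast
  have "(norm (snd v))\<^sup>2 = (fst v)\<^sup>2"
    using v by (simp add: lightlike_def lorentz_form_def dot_square_norm flip: power2_eq_square)
  then have nv: "norm (snd v) = \<bar>fst v\<bar>" by (metis abs_norm_cancel real_sqrt_abs)
  then have f: "fst v \<noteq> 0" using v by (auto simp: lightlike_def prod_eq_iff)
  define u where "u = (1 / fst v) *\<^sub>R snd v"
  have u: "norm u = 1" using nv f by (simp add: u_def)
  have vu: "v = fst v *\<^sub>R (1, u)" using f by (simp add: u_def prod_eq_iff)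
  define \<theta> where "\<theta> = sgn d"
  have "d \<noteq> 0" using nz[of 0] by simp
  then have \<theta>: "\<theta> \<noteq> 0" by (simp add: \<theta>_def sgn_zero_iff)
  have pos: "0 < \<theta> * c * s + \<theta> * d" if "s \<in> I" for s
  proof (rule ccontr)
    assume neg: "\<not> ?thesis"
    have d: "0 < \<theta> * d" using \<open>d \<noteq> 0\<close> by (simp add: \<theta>_def sgn_mult_self_eq abs_sgn[symmetric] mult.commute)
    \<comment> \<open>A change of sign between 0 and \<open>s\<close> would give a zero of the
      denominator, that is, a pole inside \<open>I\<close>.\<close>
    have "\<exists>r. 0 \<le> r \<and> r \<le> 1 \<and> \<theta> * c * (r * s) + \<theta> * d = 0"
    proof -
      have cont: "\<forall>r. 0 \<le> r \<and> r \<le> 1 \<longrightarrow> isCont (\<lambda>r. \<theta> * c * (r * s) + \<theta> * d) r" by simp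
      show ?thesis
        using IVT2[of "\<lambda>r. \<theta> * c * (r * s) + \<theta> * d" 1 0 0] neg d by auto
    qed
    then obtain r where r: "0 \<le> r" "r \<le> 1" "\<theta> * c * (r * s) + \<theta> * d = 0" by blast
    have "\<bar>r * s\<bar> \<le> \<bar>s\<bar>" using r by (simp add: abs_mult mult_left_le_one_le)
    then have "r * s \<in> I" using that by auto
    moreover have "\<theta> * (c * (r * s) + d) = 0" using r(3) by (simp add: algebra_simps)
    ultimately show False using nz \<theta> by simp
  qed
  \<comment> \<open>The sign of the determinant after scaling by \<open>fst v\<close>.\<close>
  define \<eta> where "\<eta> = sgn (fst v * (a * d - b * c))"
  have \<eta>: "\<eta> = 1 \<or> \<eta> = -1" using f det by (auto simp: \<eta>_def sgn_if)
  show thesis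
  proof (rule that[of u "\<eta> * \<theta> * fst v * a" "\<theta> * d" "\<theta> * fst v * b" "\<eta> * \<theta> * c" \<eta> x])
    show "norm u = 1" by (rule u)
    show "\<eta> = 1 \<or> \<eta> = -1" by (rule \<eta>)
    have "\<eta> * \<theta> * fst v * a * (\<theta> * d) - \<theta> * fst v * b * (\<eta> * \<theta> * c)
        = \<theta>\<^sup>2 * (\<eta> * (fst v * (a * d - b * c)))"
      by (simp add: power2_eq_square algebra_simps)
    moreover have "0 < \<eta> * (fst v * (a * d - b * c))"
      using f det by (simp add: \<eta>_def sgn_mult_self_eq abs_sgn[symmetric] mult.commute)
    ultimately show "0 < \<eta> * \<theta> * fst v * a * (\<theta> * d) - \<theta> * fst v * b * (\<eta> * \<theta> * c)"
      using \<theta> by simp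
    fix s assume s: "s \<in> I"
    have "\<eta> * s \<in> I" using \<eta> s by auto
    then show "0 < \<eta> * \<theta> * c * s + \<theta> * d" using pos[of "\<eta> * s"] by (simp add: ac_simps)
    have "\<eta> * \<theta> * fst v * a * (\<eta> * s) + \<theta> * fst v * b = \<theta> * (fst v * (a * s + b))"
      using \<eta> by (auto simp: algebra_simps)
    moreover have "\<eta> * \<theta> * c * (\<eta> * s) + \<theta> * d = \<theta> * (c * s + d)"
      using \<eta> by (auto simp: algebra_simps)
    ultimately have "(\<eta> * \<theta> * fst v * a * (\<eta> * s) + \<theta> * fst v * b) / (\<eta> * \<theta> * c * (\<eta> * s) + \<theta> * d)
        = h s * fst v"
      using \<theta> hs[OF s] by simp
    moreover have "\<gamma> s = x + (h s * fst v) *\<^sub>R (1, u)"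
      using \<gamma>[OF s] vu by (metis scaleR_scaleR)
    ultimately show "\<gamma> s = x + ((\<eta> * \<theta> * fst v * a * (\<eta> * s) + \<theta> * fst v * b)
        / (\<eta> * \<theta> * c * (\<eta> * s) + \<theta> * d)) *\<^sub>R (1, u)" by simp
  qed
qed

text \<open>Schwarz lemma for \<open>\<rho>\<^sub>I\<close>: the left end of the image of \<open>I\<close> is the limit of \<open>h r\<close> for \<open>r \<rightarrow> -1\<close>.\<close>

lemma homography_ln_ratio_le_rho_I:
  fixes a b c d :: real
  defines "h \<equiv> \<lambda>s. (a * s + b) / (c * s + d)"
  assumes det: "0 < a * d - b * c" and pos: "\<And>s. s \<in> I \<Longrightarrow> 0 < c * s + d"
    and st: "s \<in> I" "t \<in> I" "s < t"
  shows "\<And>r q. r \<in> I \<Longrightarrow> q \<in> I \<Longrightarrow> r < q \<Longrightarrow> h r < h q"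
    and "(\<And>r. r \<in> I \<Longrightarrow> r < s \<Longrightarrow> M \<le> R * ln ((h t - h r) / (h s - h r))) \<Longrightarrow> 0 \<le> R \<Longrightarrow> M \<le> R * rho_I s t"
proof -
  have diff: "h q - h r = (a * d - b * c) * (q - r) / ((c * q + d) * (c * r + d))"
    if "r \<in> I" "q \<in> I" for r q
    using pos[OF that(1)] pos[OF that(2)] by (simp add: h_def divide_simps) (simp add: algebra_simps)
  then show inc: "h r < h q" if "r \<in> I" "q \<in> I" "r < q" for r q
    using that det pos[of r] pos[of q] zero_less_divide_iff diff_gt_0_iff_gt mult_pos_pos by metis
  assume M: "\<And>r. r \<in> I \<Longrightarrow> r < s \<Longrightarrow> M \<le> R * ln ((h t - h r) / (h s - h r))" and "0 \<le> R"
  \<comment> \<open>The denominator is positive on \<open>I\<close>, hence nonnegative at the end 1;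
    otherwise its zero \<open>- d / c\<close> would lie in \<open>I\<close>.\<close>
  have cd: "0 \<le> c + d"
  proof (rule ccontr)
    assume "\<not> ?thesis"
    moreover have "0 < d" using pos[of 0] by simp
    ultimately have c: "c < 0" "d < - c" by linarith+
    then have "- d / c \<in> I" using \<open>0 < d\<close> by (auto simp: divide_simps)
    from pos[OF this] show False using c by simp
  qed
  have "M \<le> R * ln ((t - r) / (s - r) * ((1 - s) / (1 - t)))" if r: "r \<in> I" "r < s" for r
  proof -
    have ps: "0 < c * s + d" "0 < c * t + d" "0 < c * r + d" using pos st r by auto
    have "(h t - h r) / (h s - h r) = (t - r) / (s - r) * ((c * s + d) / (c * t + d))"
      using ps det r st by (simp add: diff divide_simps)
    \<comment> \<open>Equality holds when the pole of \<open>h\<close> sits at 1, the case of a full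
      ray going to infinity. After this comparison \<open>h\<close> has disappeared and only the
      limit in \<open>r\<close> remains.\<close>
    also have "\<dots> \<le> (t - r) / (s - r) * ((1 - s) / (1 - t))"
    proof (rule mult_left_mono)
      have "(c * t + d) * (1 - s) - (c * s + d) * (1 - t) = (c + d) * (t - s)" by (simp add: algebra_simps)
      also have "\<dots> \<ge> 0" using cd st by simp
      finally show "(c * s + d) / (c * t + d) \<le> (1 - s) / (1 - t)"
        using ps st by (simp add: divide_simps mult.commute)
    qed (use r st in simp)
    finally have "(h t - h r) / (h s - h r) \<le> (t - r) / (s - r) * ((1 - s) / (1 - t))" .
    moreover have "0 < (h t - h r) / (h s - h r)" using inc[of r s] inc[of r t] r st by simp
    ultimately have "ln ((h t - h r) / (h s - h r)) \<le> ln ((t - r) / (s - r) * ((1 - s) / (1 - t)))"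
      by (subst ln_le_cancel_iff) auto
    then show ?thesis using M[OF r] \<open>0 \<le> R\<close> mult_left_mono order_trans by blast
  qed
  moreover have "\<forall>\<^sub>F r in at_right (-1). r \<in> {-1<..<s}"
    using st by (intro eventually_at_right_real) auto
  ultimately have ev: "\<forall>\<^sub>F r in at_right (-1). M \<le> R * ln ((t - r) / (s - r) * ((1 - s) / (1 - t)))"
    using st by (auto elim!: eventually_mono)
  have lim: "((\<lambda>r. R * ln ((t - r) / (s - r) * ((1 - s) / (1 - t)))) \<longlongrightarrow>
      R * ln ((t - (-1)) / (s - (-1)) * ((1 - s) / (1 - t)))) (at_right (-1))"
    using st by (intro tendsto_intros) auto
  have "M \<le> R * ln ((t - (-1)) / (s - (-1)) * ((1 - s) / (1 - t)))"
    by (rule tendsto_lowerbound[OF lim ev]) simp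
  also have "(t - (-1)) / (s - (-1)) * ((1 - s) / (1 - t)) = ((s - 1) * (t + 1)) / ((s + 1) * (t - 1))"
    using st by (simp add: divide_simps) (simp add: algebra_simps)
  also have "R * ln \<dots> \<le> R * rho_I s t" using \<open>0 \<le> R\<close> by (simp add: rho_I_def mult_left_mono)
  finally show "M \<le> R * rho_I s t" .
qed

section \<open>Chains of projectively parametrized null geodesics\<close>

text \<open>The side condition in \<open>markowitz_dist\<close>, split off so that chains can be
  prolonged one geodesic at a time.\<close>

definition markowitz_chain ::
    "'n::finite minkowski set \<Rightarrow> nat \<Rightarrow> (nat \<Rightarrow> real \<Rightarrow> 'n minkowski) \<Rightarrow> (nat \<Rightarrow> real) \<Rightarrow> (nat \<Rightarrow> real)
      \<Rightarrow> 'n minkowski \<Rightarrow> 'n minkowski \<Rightarrow> bool" where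
  "markowitz_chain \<Omega> m \<gamma> s t x y \<longleftrightarrow> 1 \<le> m \<and>
      (\<forall>k\<in>{1..m}. projective_lightlike_geodesic \<Omega> (\<gamma> k) \<and> s k \<in> I \<and> t k \<in> I) \<and>
      \<gamma> 1 (s 1) = x \<and> \<gamma> m (t m) = y \<and>
      (\<forall>k\<in>{1..<m}. \<gamma> k (t k) = \<gamma> (k + 1) (s (k + 1)))"

definition markowitz_sums :: "'n::finite minkowski set \<Rightarrow> 'n minkowski \<Rightarrow> 'n minkowski \<Rightarrow> real set" where
  "markowitz_sums \<Omega> x y = {(\<Sum>k\<in>{1..m}. rho_I (s k) (t k)) | m \<gamma> s t. markowitz_chain \<Omega> m \<gamma> s t x y}"

lemma markowitz_dist_eq: "markowitz_dist \<Omega> x y = Inf (markowitz_sums \<Omega> x y)"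
  unfolding markowitz_dist_def markowitz_sums_def markowitz_chain_def ..

lemma markowitz_sums_single:
  assumes "projective_lightlike_geodesic \<Omega> \<gamma>" "\<sigma> \<in> I" "\<tau> \<in> I"
  shows "rho_I \<sigma> \<tau> \<in> markowitz_sums \<Omega> (\<gamma> \<sigma>) (\<gamma> \<tau>)"
  unfolding markowitz_sums_def mem_Collect_eq
  by (intro exI[of _ 1] exI[of _ "\<lambda>_. \<gamma>"] exI[of _ "\<lambda>_. \<sigma>"] exI[of _ "\<lambda>_. \<tau>"])
    (use assms in \<open>simp add: markowitz_chain_def\<close>)

lemma markowitz_sums_snoc:
  assumes "r \<in> markowitz_sums \<Omega> x (\<gamma> \<sigma>)" "projective_lightlike_geodesic \<Omega> \<gamma>" "\<sigma> \<in> I" "\<tau> \<in> I"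
  shows "r + rho_I \<sigma> \<tau> \<in> markowitz_sums \<Omega> x (\<gamma> \<tau>)"
proof -
  obtain m \<gamma>' s t where r: "r = (\<Sum>k\<in>{1..m}. rho_I (s k) (t k))"
    and ch: "markowitz_chain \<Omega> m \<gamma>' s t x (\<gamma> \<sigma>)"
    using assms(1) unfolding markowitz_sums_def by auto
  define m' where "m' = Suc m"
  define s' where "s' = s(m' := \<sigma>)"
  define t' where "t' = t(m' := \<tau>)"
  define \<gamma>'' where "\<gamma>'' = \<gamma>'(m' := \<gamma>)"
  have "r + rho_I \<sigma> \<tau> = (\<Sum>k\<in>{1..m'}. rho_I (s' k) (t' k))"
    by (simp add: r m'_def s'_def t'_def)
  moreover have "\<gamma>'' k (t' k) = \<gamma>'' (k + 1) (s' (k + 1))" if "k \<in> {1..<m'}" for k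
    using that ch by (cases "k = m") (auto simp: m'_def s'_def t'_def \<gamma>''_def markowitz_chain_def)
  then have "markowitz_chain \<Omega> m' \<gamma>'' s' t' x (\<gamma> \<tau>)"
    using ch assms unfolding markowitz_chain_def
    by (auto simp: m'_def s'_def t'_def \<gamma>''_def le_Suc_eq)
  ultimately show ?thesis
    unfolding markowitz_sums_def by blast
qed

section \<open>Geometry of \<Omega> and of its frontier\<close>

locale stably_acausal_domain =
  fixes \<epsilon> :: real and \<Omega> :: "'n::finite minkowski set"
  assumes eps_pos: "0 < \<epsilon>"
    and dom: "domain \<Omega>"
    and complete: "future_complete \<Omega>"
    and acausal: "stably_acausal \<epsilon> (frontier \<Omega>)"
begin

lemma open_Omega: "open \<Omega>"
  using dom by (simp add: domain_def)

lemma causal_future_in: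
  assumes "x \<in> \<Omega>" "norm (snd d) \<le> fst d"
  shows "x + d \<in> \<Omega>"
proof (cases "d = 0")
  case False
  then have "future_causal minkowski_form d"
    using assms by (simp add: future_causal_lorentz_iff)
  from future_causal_curve_segment[OF this, of x]
  have "path_image (\<lambda>s. x + s *\<^sub>R d) \<subseteq> \<Omega>"
    using complete assms(1) unfolding future_complete_def by (auto simp: pathstart_def)
  then show ?thesis by (auto simp: path_image_def image_subset_iff dest: bspec[of _ _ 1])
qed (use assms in simp)

text \<open>The parameters for which the past ray stays in \<Omega> form an open set, closed
  downwards by future completeness and bounded by \<open>b\<close>. Its supremum is the exit
  parameter.\<close>

lemma ray_exit:
  fixes d :: "'n minkowski"
  assumes "x \<in> \<Omega>" "norm (snd d) \<le> fst d" "0 \<le> b" "x - b *\<^sub>R d \<notin> \<Omega>"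
  obtains s where "0 < s" "s \<le> b" "x - s *\<^sub>R d \<in> frontier \<Omega>" "x - s *\<^sub>R d \<notin> \<Omega>"
    "\<And>r. r < s \<Longrightarrow> x - r *\<^sub>R d \<in> \<Omega>"
proof -
  define A where "A = {s. x - s *\<^sub>R d \<in> \<Omega>}"
  have "A = (\<lambda>s. x - s *\<^sub>R d) -` \<Omega>" by (auto simp: A_def)
  then have "open A"
    using open_Omega by (auto intro!: continuous_open_vimage continuous_intros)
  have down: "r \<in> A" if "r \<le> s" "s \<in> A" for r s
  proof -
    have "norm (snd ((s - r) *\<^sub>R d)) \<le> fst ((s - r) *\<^sub>R d)"
      using that assms(2) by (simp add: mult_left_mono)
    from causal_future_in[OF _ this, of "x - s *\<^sub>R d"] that(2) show ?thesis
      by (simp add: A_def algebra_simps)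
  qed
  have ub: "r < b" if "r \<in> A" for r
    using that down[of b r] assms(4) by (force simp: A_def not_less[symmetric])
  have "0 \<in> A" using assms(1) by (simp add: A_def)
  define s where "s = Sup A"
  have bdd: "bdd_above A" using ub by (intro bdd_aboveI[of _ b]) (simp add: less_imp_le)
  have low: "r \<in> A" if "r < s" for r
    using that down less_cSup_iff[of A r] bdd \<open>0 \<in> A\<close> unfolding s_def by (metis empty_iff less_imp_le)
  have "s \<notin> A"
  proof
    assume "s \<in> A"
    with \<open>open A\<close> obtain e where "0 < e" "ball s e \<subseteq> A" by (auto simp: open_contains_ball)
    then have "s + e / 2 \<in> A" by (auto simp: dist_real_def subset_iff)
    from cSup_upper[OF this bdd] show False using \<open>0 < e\<close> by (simp add: s_def)
  qed
  have "0 \<le> s" using cSup_upper[OF \<open>0 \<in> A\<close> bdd] by (simp add: s_def)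
  then have "0 < s" using \<open>s \<notin> A\<close> \<open>0 \<in> A\<close> by (cases "s = 0") auto
  have "s \<le> b" unfolding s_def using \<open>0 \<in> A\<close> ub by (intro cSup_least) (auto intro: less_imp_le)
  have "x - s *\<^sub>R d \<in> closure \<Omega>"
  proof (rule Lim_in_closed_set[of _ "\<lambda>r. x - r *\<^sub>R d" "at_left s"])
    show "\<forall>\<^sub>F r in at_left s. x - r *\<^sub>R d \<in> closure \<Omega>"
      using closure_subset low by (auto simp: A_def eventually_at_left_field intro!: exI[of _ "s - 1"])
    show "((\<lambda>r. x - r *\<^sub>R d) \<longlongrightarrow> x - s *\<^sub>R d) (at_left s)"
      by (intro tendsto_intros)
  qed auto
  moreover have "x - s *\<^sub>R d \<notin> \<Omega>" using \<open>s \<notin> A\<close> by (simp add: A_def)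
  ultimately have "x - s *\<^sub>R d \<in> frontier \<Omega>"
    using open_Omega by (simp add: frontier_def interior_open)
  with \<open>0 < s\<close> \<open>s \<le> b\<close> \<open>x - s *\<^sub>R d \<notin> \<Omega>\<close> low show thesis
    by (intro that) (auto simp: A_def)
qed

lemma vertical_exit:
  obtains b where "0 \<le> b" "x - b *\<^sub>R (1, 0) \<notin> \<Omega>"
proof -
  obtain y where y: "y \<notin> \<Omega>" using dom by (auto simp: domain_def)
  \<comment> \<open>With this \<open>b\<close> a point \<open>y\<close> outside \<Omega> is in the
    causal future of \<open>x - b *\<^sub>R (1, 0)\<close>.\<close>
  define b where "b = norm (snd (y - x)) + \<bar>fst (x - y)\<bar>"
  have "x - b *\<^sub>R (1, 0) \<notin> \<Omega>"
  proof
    assume "x - b *\<^sub>R (1, 0) \<in> \<Omega>"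
    moreover have "norm (snd (y - x + b *\<^sub>R (1, 0))) \<le> fst (y - x + b *\<^sub>R (1, 0))"
      by (simp add: b_def)
    ultimately have "x - b *\<^sub>R (1, 0) + (y - x + b *\<^sub>R (1, 0)) \<in> \<Omega>" by (rule causal_future_in)
    then show False using y by simp
  qed
  moreover have "0 \<le> b" by (simp add: b_def)
  ultimately show thesis by (rule that[rotated])
qed

text \<open>Stable acausality upgrades future completeness to the wide cone. If \<open>x + d\<close>
  were outside, the vertical line through \<open>x\<close> would meet the frontier strictly below
  \<open>x\<close>, and the one through \<open>x + d\<close> at or above \<open>x + d\<close>. These
  two frontier points would be causally related for the wide cone.\<close>

lemma wide_causal_future_in:
  assumes "x \<in> \<Omega>" "norm (snd d) \<le> (1 + \<epsilon>) * fst d"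
  shows "x + d \<in> \<Omega>"
proof (rule ccontr)
  assume out: "x + d \<notin> \<Omega>"
  obtain b where "0 \<le> b" "x - b *\<^sub>R (1, 0) \<notin> \<Omega>" by (rule vertical_exit)
  then obtain s where s: "0 < s" "x - s *\<^sub>R (1, 0) \<in> frontier \<Omega>"
    using ray_exit[OF assms(1), of "(1, 0)" b] by auto
  \<comment> \<open>Raising \<open>x + d\<close> by \<open>c\<close> brings it into the ordinary
    causal future of \<open>x\<close>, hence into \<Omega>; the descent from there must then
    exit.\<close>
  define c where "c = norm (snd d) + \<bar>fst d\<bar>"
  have top: "x + d + c *\<^sub>R (1, 0) \<in> \<Omega>"
    using causal_future_in[OF assms(1), of "d + c *\<^sub>R (1, 0)"] by (simp add: c_def add.assoc)
  have "0 \<le> c" by (simp add: c_def)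
  then obtain r where r: "r \<le> c" "x + d + c *\<^sub>R (1, 0) - r *\<^sub>R (1, 0) \<in> frontier \<Omega>"
    using ray_exit[OF top, of "(1, 0)" c] out by auto
  define y where "y = x - s *\<^sub>R (1, 0)"
  define z where "z = x + d + c *\<^sub>R (1, 0) - r *\<^sub>R (1, 0)"
  have zy: "z - y = d + (s + c - r) *\<^sub>R (1, 0)" by (simp add: y_def z_def algebra_simps)
  have "0 \<le> (1 + \<epsilon>) * fst d" using assms(2) norm_ge_zero order_trans by blast
  then have "0 \<le> fst d" using eps_pos by (simp add: zero_le_mult_iff)
  then have "0 < fst (z - y)" using zy s r by simp
  then have "z \<noteq> y" by auto
  have "(1 + \<epsilon>) * fst d \<le> (1 + \<epsilon>) * fst (z - y)" using zy s r eps_pos by simp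
  then have "norm (snd (z - y)) \<le> (1 + \<epsilon>) * fst (z - y)"
    using assms(2) zy by simp
  then have "causal_le (lorentz_form \<epsilon>) y z"
    using causal_le_lorentzI[of \<epsilon> z y] eps_pos by (simp add: less_imp_le)
  then show False
    using acausal s r \<open>z \<noteq> y\<close> unfolding stably_acausal_def causally_related_def y_def z_def by metis
qed

section \<open>Cosmological time: finiteness, positivity, monotonicity\<close>

abbreviation \<tau> :: "'n minkowski \<Rightarrow> real" where
  "\<tau> \<equiv> cosmological_time \<Omega>"

lemma cosmological_time_eq:
  "\<tau> x = Sup {sqrt (interval_sq (x - z)) | z. z \<in> \<Omega> \<and> norm (snd (x - z)) \<le> fst (x - z)}"
proof -
  have "lorentz_dist z x = sqrt (interval_sq (x - z))" if "norm (snd (x - z)) \<le> fst (x - z)" for z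
  proof -
    have "minkowski_form (x - z) (x - z) = - interval_sq (x - z)"
      by (simp add: lorentz_form_def interval_sq_def power2_norm_eq_inner)
        (simp add: power2_eq_square algebra_simps)
    then show ?thesis using causal_interval_sq_nonneg[OF that] by (simp add: lorentz_dist_def)
  qed
  then have "{lorentz_dist z x | z. z \<in> \<Omega> \<inter> causal_past x}
      = {sqrt (interval_sq (x - z)) | z. z \<in> \<Omega> \<and> norm (snd (x - z)) \<le> fst (x - z)}"
    by (force simp: causal_past_def causal_le_minkowski_iff)
  then show ?thesis by (simp add: cosmological_time_def)
qed

text \<open>The content is that the supremum defining \<tau> is finite. A point
  \<open>x - b *\<^sub>R (1, 0)\<close> outside \<Omega> is not in the wide future of any
  \<open>w\<close> in \<Omega>, so \<open>T < b + D / (1 + \<epsilon>)\<close>; as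
  \<open>D \<le> T\<close> for past points, \<open>T\<close> is at most
  \<open>b * (1 + \<epsilon>) / \<epsilon>\<close>.\<close>

lemma interval_sq_le_tau_sq:
  assumes "z \<in> \<Omega>" "norm (snd (x - z)) \<le> fst (x - z)"
  shows "sqrt (interval_sq (x - z)) \<le> \<tau> x" "interval_sq (x - z) \<le> (\<tau> x)\<^sup>2"
proof -
  obtain b where b: "0 \<le> b" "x - b *\<^sub>R (1, 0) \<notin> \<Omega>" by (rule vertical_exit)
  define k where "k = (1 + \<epsilon>) / \<epsilon>"
  have "sqrt (interval_sq (x - w)) \<le> k * b" if w: "w \<in> \<Omega>" "norm (snd (x - w)) \<le> fst (x - w)" for w
  proof -
    define T D where "T = fst (x - w)" and "D = norm (snd (x - w))"
    have "T < b + D / (1 + \<epsilon>)"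
    proof (rule ccontr)
      assume *: "\<not> ?thesis"
      have "w + (x - w - b *\<^sub>R (1, 0)) \<in> \<Omega>"
      proof (rule wide_causal_future_in[OF w(1)])
        have "D / (1 + \<epsilon>) \<le> T - b" using * by simp
        then have "D \<le> (T - b) * (1 + \<epsilon>)" using eps_pos by (subst (asm) pos_divide_le_eq) auto
        then show "norm (snd (x - w - b *\<^sub>R (1, 0))) \<le> (1 + \<epsilon>) * fst (x - w - b *\<^sub>R (1, 0))"
          by (simp add: T_def D_def mult.commute)
      qed
      then show False using b by simp
    qed
    moreover have "D / (1 + \<epsilon>) \<le> T / (1 + \<epsilon>)"
      using w(2) eps_pos by (simp add: T_def D_def divide_right_mono)
    ultimately have "T < b + T / (1 + \<epsilon>)" by linarith
    then have "T \<le> k * b" using eps_pos by (simp add: k_def field_simps)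
    moreover have "interval_sq (x - w) \<le> T\<^sup>2" by (simp add: interval_sq_def T_def)
    moreover have "0 \<le> T" using w(2) norm_ge_zero order_trans unfolding T_def by blast
    ultimately show ?thesis using real_le_lsqrt real_sqrt_le_mono real_sqrt_unique order_trans by metis
  qed
  then show *: "sqrt (interval_sq (x - z)) \<le> \<tau> x"
    unfolding cosmological_time_eq using assms by (intro cSup_upper bdd_aboveI[of _ "k * b"]) blast+
  show "interval_sq (x - z) \<le> (\<tau> x)\<^sup>2"
    using sqrt_le_D[OF *] .
qed

lemma tau_pos:
  assumes "x \<in> \<Omega>"
  shows "0 < \<tau> x"
proof -
  obtain b where "0 \<le> b" "x - b *\<^sub>R (1, 0) \<notin> \<Omega>" by (rule vertical_exit)
  then obtain s where s: "0 < s" "x - (s / 2) *\<^sub>R (1, 0) \<in> \<Omega>"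
    using ray_exit[OF assms, of "(1, 0)" b] by (metis field_less_half_sum fst_conv half_gt_zero_iff
      less_add_same_cancel1 norm_zero order.refl snd_conv zero_le_one field_sum_of_halves)
  have "s / 2 \<le> \<tau> x"
    using interval_sq_le_tau_sq(1)[OF s(2), of x] s(1) by (simp add: interval_sq_def)
  then show ?thesis using s(1) by simp
qed

lemma tau_sq_le:
  assumes "x \<in> \<Omega>"
    and "\<And>z. z \<in> \<Omega> \<Longrightarrow> norm (snd (x - z)) \<le> fst (x - z) \<Longrightarrow> interval_sq (x - z) \<le> M"
  shows "(\<tau> x)\<^sup>2 \<le> M"
proof -
  have "0 \<le> M" using assms(2)[OF assms(1)] by (simp add: interval_sq_def)
  have "\<tau> x \<le> sqrt M"
    unfolding cosmological_time_eq
  proof (rule cSup_least)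
    have "norm (snd (x - x)) \<le> fst (x - x)" by simp
    with assms(1)
    show "{sqrt (interval_sq (x - z)) |z. z \<in> \<Omega> \<and> norm (snd (x - z)) \<le> fst (x - z)} \<noteq> {}"
      by blast
  qed (use assms(2) in auto)
  then show ?thesis
    using tau_pos[OF assms(1)] \<open>0 \<le> M\<close> power_mono[of "\<tau> x" "sqrt M" 2] by simp
qed

lemma tau_mono:
  assumes "x \<in> \<Omega>" "norm (snd (y - x)) \<le> fst (y - x)"
  shows "\<tau> x \<le> \<tau> y"
proof -
  have y: "y \<in> \<Omega>" using causal_future_in[OF assms] by simp
  have "(\<tau> x)\<^sup>2 \<le> (\<tau> y)\<^sup>2"
  proof (rule tau_sq_le[OF assms(1)])
    fix z assume z: "z \<in> \<Omega>" "norm (snd (x - z)) \<le> fst (x - z)"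
    have n: "norm (snd (y - z)) \<le> norm (snd (y - x)) + norm (snd (x - z))"
      using norm_triangle_ineq[of "snd (y - x)" "snd (x - z)"] by simp
    have "norm (snd (y - z)) \<le> fst (y - z)" using n z assms by simp
    from interval_sq_le_tau_sq(2)[OF z(1) this] have "interval_sq (y - z) \<le> (\<tau> y)\<^sup>2" .
    moreover have "interval_sq (x - z) \<le> interval_sq (y - z)"
    proof -
      define a b c d e where "a = fst (x - z)" "b = norm (snd (x - z))"
        "c = fst (y - x)" "d = norm (snd (y - x))" "e = norm (snd (y - z))"
      have h: "0 \<le> b" "b \<le> a" "0 \<le> d" "d \<le> c" using z assms by (auto simp: a_b_c_d_e_def)
      have "e\<^sup>2 \<le> (d + b)\<^sup>2" using n by (intro power_mono) (auto simp: a_b_c_d_e_def)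
      moreover have "d * b \<le> c * a" "d\<^sup>2 \<le> c\<^sup>2" using h by (auto intro: mult_mono power_mono)
      \<comment> \<open>The three summands are nonnegative by the triangle inequality, by causality
        of \<open>y - x\<close>, and by causality of both \<open>y - x\<close> and
        \<open>x - z\<close>.\<close>
      moreover have "interval_sq (y - z) - interval_sq (x - z)
          = ((d + b)\<^sup>2 - e\<^sup>2) + (c\<^sup>2 - d\<^sup>2) + 2 * (c * a - d * b)"
      proof -
        have "fst (y - z) = c + a" by (simp add: a_b_c_d_e_def)
        then have "interval_sq (y - z) = (c + a)\<^sup>2 - e\<^sup>2" "interval_sq (x - z) = a\<^sup>2 - b\<^sup>2"
          by (simp_all only: interval_sq_def a_b_c_d_e_def)
        then show ?thesis by (simp add: power2_eq_square algebra_simps)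
      qed
      moreover have "0 \<le> ((d + b)\<^sup>2 - e\<^sup>2) + (c\<^sup>2 - d\<^sup>2) + 2 * (c * a - d * b)"
        using calculation(1-3) by (intro add_nonneg_nonneg) simp_all
      ultimately show ?thesis by simp
    qed
    ultimately show "interval_sq (x - z) \<le> (\<tau> y)\<^sup>2" by simp
  qed
  then show ?thesis by (rule power2_le_imp_le) (use tau_pos[OF y] in simp)
qed

text \<open>A past point \<open>z\<close> of the translate need not be in the past of
  \<open>x\<close>. If it is not, the interval from \<open>z\<close> to \<open>x\<close> is
  nonpositive and the bound is trivial.\<close>

lemma past_of_null_translate:
  assumes "norm u = 1" "0 \<le> h" "z \<in> \<Omega>"
    and "norm (snd (x + h *\<^sub>R (1, u) - z)) \<le> fst (x + h *\<^sub>R (1, u) - z)"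
  shows "interval_sq (x - z) \<le> (\<tau> x)\<^sup>2"
proof (cases "0 < interval_sq (x - z)")
  case True
  have "norm (snd (x - z)) \<le> fst (x - z)"
    using timelike_before_null_translate[OF assms(1,2) True] assms(4) by (simp add: algebra_simps)
  then show ?thesis using interval_sq_le_tau_sq(2)[OF assms(3)] by simp
next
  case False
  then show ?thesis using zero_le_power2[of "\<tau> x"] by linarith
qed

section \<open>Minimal growth of \<tau> along null rays\<close>

text \<open>Each past point \<open>z\<close> contributes an affine function
  \<open>A + a * B\<close>. Here \<open>A \<le> 0\<close>, since otherwise \<open>q\<close> would be
  in the future of \<open>z\<close> and so in \<Omega>; hence
  \<open>b * (A + a * B) \<le> a * (A + b * B)\<close>.\<close>

lemma tau_sq_growth:
  assumes "q \<notin> \<Omega>" "norm u = 1" "0 < a" "a \<le> b" "q + a *\<^sub>R (1, u) \<in> \<Omega>"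
  shows "b * (\<tau> (q + a *\<^sub>R (1, u)))\<^sup>2 \<le> a * (\<tau> (q + b *\<^sub>R (1, u)))\<^sup>2"
proof -
  let ?x = "q + a *\<^sub>R (1, u)" and ?y = "q + b *\<^sub>R (1, u)"
  have "(\<tau> ?x)\<^sup>2 \<le> a / b * (\<tau> ?y)\<^sup>2"
  proof (rule tau_sq_le[OF assms(5)])
    fix z assume z: "z \<in> \<Omega>" "norm (snd (?x - z)) \<le> fst (?x - z)"
    define A B where "A = interval_sq (q - z)" and "B = 2 * (fst (q - z) - u \<bullet> snd (q - z))"
    have x: "interval_sq (?x - z) = A + a * B" and y: "interval_sq (?y - z) = A + b * B"
      using interval_sq_add_null[OF assms(2), of "q - z"] by (simp_all add: A_def B_def algebra_simps)
    have "A \<le> 0"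
    proof (rule ccontr)
      assume "\<not> A \<le> 0"
      then have "norm (snd (q - z)) \<le> fst (q - z)"
        using timelike_before_null_translate[OF assms(2), of a "q - z"] z(2) assms(3)
        by (simp add: A_def algebra_simps)
      from causal_future_in[OF z(1) this] assms(1) show False by simp
    qed
    have "norm (snd ((b - a) *\<^sub>R (1, u))) \<le> fst ((b - a) *\<^sub>R (1, u))" using assms by simp
    moreover have "?y - z = (?x - z) + (b - a) *\<^sub>R (1, u)" by (simp add: algebra_simps)
    ultimately have "norm (snd (?y - z)) \<le> fst (?y - z)"
      using z(2) norm_triangle_ineq[of "snd (?x - z)" "snd ((b - a) *\<^sub>R (1, u))"] by (simp add: algebra_simps)
    from interval_sq_le_tau_sq(2)[OF z(1) this] have "A + b * B \<le> (\<tau> ?y)\<^sup>2" by (simp only: y)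
    then have "a * (A + b * B) \<le> a * (\<tau> ?y)\<^sup>2" using assms(3) by simp
    moreover have "b * A \<le> a * A" using \<open>A \<le> 0\<close> assms(4) by (intro mult_right_mono_neg)
    ultimately have "b * (A + a * B) \<le> a * (\<tau> ?y)\<^sup>2" by (simp add: algebra_simps)
    then show "interval_sq (?x - z) \<le> a / b * (\<tau> ?y)\<^sup>2"
      unfolding x using assms by (simp add: field_simps)
  qed
  then show ?thesis using assms by (simp add: field_simps)
qed

text \<open>The longest geodesic is used: the whole null ray from its exit point \<open>q\<close> to
  infinity, parametrized by \<open>(1 + r) / (1 - r)\<close>. On it the distance of \<open>a\<close>
  and \<open>a + l\<close> is \<open>ln ((a + l) / a)\<close>, and \<open>tau_sq_growth\<close>
  bounds this ratio.\<close>

lemma null_segment_geodesic: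
  assumes "x \<in> \<Omega>" "norm u = 1" "0 \<le> l"
  obtains \<gamma> s t where "projective_lightlike_geodesic \<Omega> \<gamma>" "s \<in> I" "t \<in> I"
    "\<gamma> s = x" "\<gamma> t = x + l *\<^sub>R (1, u)"
    "rho_I s t \<le> 2 * (ln (\<tau> (x + l *\<^sub>R (1, u))) - ln (\<tau> x))"
proof -
  have null: "norm (snd (1::real, u)) \<le> fst (1::real, u)" using assms(2) by simp
  obtain b where b: "0 \<le> b" "x - b *\<^sub>R (1, 0) \<notin> \<Omega>" by (rule vertical_exit)
  \<comment> \<open>Chosen so that the vector from \<open>x - B *\<^sub>R (1, u)\<close> to
    \<open>x - b *\<^sub>R (1, 0)\<close> lies on the boundary of the wide cone.\<close>
  define B where "B = b * (1 + \<epsilon>) / \<epsilon>"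
  have "x - B *\<^sub>R (1, u) \<notin> \<Omega>"
  proof
    assume "x - B *\<^sub>R (1, u) \<in> \<Omega>"
    moreover have "0 \<le> B" "B = (1 + \<epsilon>) * (B - b)" using b eps_pos by (auto simp: B_def field_simps)
    then have "norm (snd (B - b, B *\<^sub>R u)) \<le> (1 + \<epsilon>) * fst (B - b, B *\<^sub>R u)"
      using assms(2) by simp
    ultimately have "x - B *\<^sub>R (1, u) + (B - b, B *\<^sub>R u) \<in> \<Omega>" by (rule wide_causal_future_in)
    moreover have "x - B *\<^sub>R (1, u) + (B - b, B *\<^sub>R u) = x - b *\<^sub>R (1, 0)"
      by (simp add: prod_eq_iff)
    ultimately show False using b(2) by metis
  qed
  moreover have "0 \<le> B" using b eps_pos by (simp add: B_def)
  ultimately obtain a where a: "0 < a" "x - a *\<^sub>R (1, u) \<notin> \<Omega>"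
    "\<And>r. r < a \<Longrightarrow> x - r *\<^sub>R (1, u) \<in> \<Omega>"
    using ray_exit[OF assms(1) null] by metis
  define q where "q = x - a *\<^sub>R (1, u)"
  have x: "x = q + a *\<^sub>R (1, u)" and y: "x + l *\<^sub>R (1, u) = q + (a + l) *\<^sub>R (1, u)"
    by (simp_all add: q_def algebra_simps)
  define \<gamma> where "\<gamma> r = q + ((1 + r) / (1 - r)) *\<^sub>R (1, u)" for r
  \<comment> \<open>The inverse of \<open>(1 + r) / (1 - r)\<close>.\<close>
  define p where "p c = (c - 1) / (c + 1)" for c :: real
  have p: "p c \<in> I" "(1 + p c) / (1 - p c) = c" if "0 < c" for c
    using that by (auto simp: p_def field_simps)
  have geo: "projective_lightlike_geodesic \<Omega> \<gamma>"
    unfolding projective_lightlike_geodesic_def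
  proof (intro conjI exI)
    show "\<gamma> ` I \<subseteq> \<Omega>"
    proof (rule image_subsetI)
      fix r assume "r \<in> I"
      then have "0 < (1 + r) / (1 - r)" by simp
      then have "x - (a - (1 + r) / (1 - r)) *\<^sub>R (1, u) \<in> \<Omega>" by (intro a(3)) simp
      also have "x - (a - (1 + r) / (1 - r)) *\<^sub>R (1, u) = \<gamma> r"
        unfolding \<gamma>_def q_def scaleR_diff_left by simp
      finally show "\<gamma> r \<in> \<Omega>" .
    qed
    have "u \<bullet> u = 1" using assms(2) by (simp add: dot_square_norm)
    then show "lightlike (1, u)" by (simp add: lightlike_def lorentz_form_def zero_prod_def)
    show "homography_on I (\<lambda>r. (1 + r) / (1 - r))"
      unfolding homography_on_def
      by (intro exI[of _ 1] exI[of _ "-1"]) auto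
    show "\<forall>r\<in>I. \<gamma> r = q + ((1 + r) / (1 - r)) *\<^sub>R (1, u)" by (simp add: \<gamma>_def)
  qed
  have pos: "0 < \<tau> x" "0 < \<tau> (x + l *\<^sub>R (1, u))"
    using tau_pos assms causal_future_in[of x "l *\<^sub>R (1, u)"] by auto
  have "(a + l) * (\<tau> x)\<^sup>2 \<le> a * (\<tau> (x + l *\<^sub>R (1, u)))\<^sup>2"
    using tau_sq_growth[OF a(2)[folded q_def] assms(2) a(1), of "a + l"] assms(1,3)
    unfolding x[symmetric] y[symmetric] by simp
  then have "ln ((a + l) * (\<tau> x)\<^sup>2) \<le> ln (a * (\<tau> (x + l *\<^sub>R (1, u)))\<^sup>2)"
    using pos a(1) assms by (subst ln_le_cancel_iff) auto
  then have "ln (a + l) - ln a \<le> 2 * (ln (\<tau> (x + l *\<^sub>R (1, u))) - ln (\<tau> x))"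
    using pos a(1) assms by (simp add: ln_mult ln_realpow)
  moreover have "rho_I (p a) (p (a + l)) = ln (a + l) - ln a"
    using p a(1) assms by (subst rho_I_eq) auto
  moreover have "\<gamma> (p a) = x" "\<gamma> (p (a + l)) = x + l *\<^sub>R (1, u)"
    using p a(1) assms x y by (simp_all add: \<gamma>_def)
  ultimately show thesis using p a(1) assms(3) geo by (intro that[of \<gamma> "p a" "p (a + l)"]) auto
qed

section \<open>Maximal growth of \<tau> along null rays\<close>

lemma tau_null_translate_ge:
  assumes "p \<in> \<Omega>" "norm u = 1" "0 < l"
  shows "\<epsilon> * l\<^sup>2 \<le> (2 + \<epsilon>) * (\<tau> (p + l *\<^sub>R (1, u)))\<^sup>2"
proof -
  \<comment> \<open>Among the points
    \<open>p + r *\<^sub>R (1, (1 + \<epsilon>) *\<^sub>R u)\<close> on the boundary of the wide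
    cone, this \<open>r\<close> maximizes the interval to \<open>p + l *\<^sub>R (1, u)\<close>; the
    remaining vector is \<open>((1 + \<epsilon>) * r, r *\<^sub>R u)\<close>.\<close>
  define r where "r = l / (2 + \<epsilon>)"
  define w where "w = (r, ((1 + \<epsilon>) * r) *\<^sub>R u)"
  have r: "0 < r" "l = (2 + \<epsilon>) * r" using assms eps_pos by (auto simp: r_def)
  have z: "p + w \<in> \<Omega>"
    using assms r eps_pos by (intro wide_causal_future_in) (auto simp: w_def)
  have d: "p + l *\<^sub>R (1, u) - (p + w) = ((1 + \<epsilon>) * r, r *\<^sub>R u)"
    by (simp add: w_def r(2) prod_eq_iff flip: scaleR_diff_left) (simp add: algebra_simps)
  have "interval_sq (p + l *\<^sub>R (1, u) - (p + w)) \<le> (\<tau> (p + l *\<^sub>R (1, u)))\<^sup>2"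
    by (rule interval_sq_le_tau_sq(2)[OF z]) (use d assms r eps_pos in simp)
  moreover have "interval_sq (p + l *\<^sub>R (1, u) - (p + w)) = \<epsilon> * (2 + \<epsilon>) * r\<^sup>2"
    unfolding d interval_sq_def using assms r by (simp add: power2_eq_square algebra_simps)
  ultimately have "(2 + \<epsilon>) * (\<epsilon> * (2 + \<epsilon>) * r\<^sup>2) \<le> (2 + \<epsilon>) * (\<tau> (p + l *\<^sub>R (1, u)))\<^sup>2"
    using eps_pos by simp
  then show ?thesis by (simp add: r(2) power_mult_distrib) (simp add: power2_eq_square algebra_simps)
qed

text \<open>A maximizer of the interval satisfies this cone condition, since the frontier is the graph
  of a \<open>1/(1 + \<epsilon>)\<close>-Lipschitz function; moving \<open>z\<close> along the wide cone avoids having to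
  find a maximizer.\<close>

lemma steep_past_point:
  assumes "z \<in> \<Omega>" "norm (snd (y - z)) \<le> fst (y - z)"
  obtains z' where "z' \<in> \<Omega>" "(1 + \<epsilon>) * norm (snd (y - z')) \<le> fst (y - z')"
    "interval_sq (y - z) \<le> interval_sq (y - z')"
proof -
  define K T where "K = 1 + \<epsilon>" and "T = fst (y - z)"
  obtain e where e: "norm e = 1" "snd (y - z) = norm (snd (y - z)) *\<^sub>R e" by (rule unit_vector_along)
  define D where "D = norm (snd (y - z))"
  have P: "snd (y - z) = D *\<^sub>R e" using e by (simp add: D_def)
  have "1 < K" using eps_pos by (simp add: K_def)
  then have K: "0 < K\<^sup>2 - 1" using one_less_power[of K 2] by simp
  have DT: "0 \<le> D" "D \<le> T" using assms(2) by (auto simp: D_def T_def)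
  show thesis
  proof (cases "K * D \<le> T")
    case True
    then show ?thesis using that[of z] assms by (simp add: K_def D_def T_def)
  next
    case False
    \<comment> \<open>The translation by \<open>r\<close> along \<open>(1, K *\<^sub>R e)\<close>
      brings the remaining vector exactly onto the boundary of the steep cone, with spatial length
      \<open>D'\<close>.\<close>
    define r where "r = (K * D - T) / (K\<^sup>2 - 1)"
    define D' where "D' = (K * T - D) / (K\<^sup>2 - 1)"
    have "0 < r" using False K by (simp add: r_def)
    have "D \<le> K * T" using DT \<open>1 < K\<close> mult_right_mono[of 1 K T] by linarith
    then have "0 \<le> D'" using K by (simp add: D'_def)
    define w where "w = (r, (K * r) *\<^sub>R e)"
    have 1: "T - r = K * D'"
      using K by (simp add: r_def D'_def divide_simps) (simp add: power2_eq_square algebra_simps)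
    have 2: "D - K * r = D'"
      using K by (simp add: r_def D'_def divide_simps) (simp add: power2_eq_square algebra_simps)
    have d: "fst (y - (z + w)) = K * D'" "snd (y - (z + w)) = D' *\<^sub>R e"
      using 1 2 P by (simp_all add: w_def T_def algebra_simps flip: scaleR_diff_left)
    have "z + w \<in> \<Omega>"
      using assms(1) e \<open>0 < r\<close> \<open>1 < K\<close> by (intro wide_causal_future_in) (auto simp: w_def K_def)
    moreover have "(1 + \<epsilon>) * norm (snd (y - (z + w))) \<le> fst (y - (z + w))"
      unfolding d using e \<open>0 \<le> D'\<close> by (simp add: K_def)
    moreover have "interval_sq (y - (z + w)) = D' * (K * T - D)"
    proof -
      have "D'\<^sup>2 * (K\<^sup>2 - 1) = D' * (K * T - D)"
        using K by (simp add: D'_def power2_eq_square)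
      then show ?thesis unfolding interval_sq_def d using e by (simp add: power_mult_distrib algebra_simps)
    qed
    moreover have "T\<^sup>2 - D\<^sup>2 \<le> D' * (K * T - D)"
    proof -
      \<comment> \<open>The gain in the interval is the square \<open>(K * D - T)\<^sup>2\<close>
        divided by \<open>K\<^sup>2 - 1\<close>.\<close>
      have "(T\<^sup>2 - D\<^sup>2) * (K\<^sup>2 - 1) = (K * T - D) * (K * T - D) - (K * D - T)\<^sup>2"
        by (simp add: power2_eq_square algebra_simps)
      also have "\<dots> \<le> (K * T - D) * (K * T - D)" by simp
      finally show ?thesis using K by (simp add: D'_def pos_le_divide_eq)
    qed
    ultimately show ?thesis using that[of "z + w"] by (simp add: interval_sq_def T_def D_def)
  qed
qed

text \<open>Going back by \<open>h\<close> lowers the interval from \<open>w\<close> by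
  \<open>2 * h * (T - u \<bullet> snd (?y - w))\<close>, at most \<open>2 * h * (T + D)\<close>. For
  a steep past point \<open>T + D\<close> is controlled by the Lorentzian length, hence by
  \<tau>.\<close>

lemma tau_sq_null_increment:
  assumes "x \<in> \<Omega>" "norm u = 1" "0 \<le> h"
  shows "(\<tau> (x + h *\<^sub>R (1, u)))\<^sup>2 \<le> (\<tau> x)\<^sup>2 + 2 * h * sqrt ((2 + \<epsilon>) / \<epsilon>) * \<tau> (x + h *\<^sub>R (1, u))"
proof (rule tau_sq_le)
  let ?y = "x + h *\<^sub>R (1, u)" and ?\<kappa> = "sqrt ((2 + \<epsilon>) / \<epsilon>)"
  show "?y \<in> \<Omega>" using assms by (intro causal_future_in) auto
  fix z assume "z \<in> \<Omega>" "norm (snd (?y - z)) \<le> fst (?y - z)"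
  then obtain w where w: "w \<in> \<Omega>" "(1 + \<epsilon>) * norm (snd (?y - w)) \<le> fst (?y - w)"
    "interval_sq (?y - z) \<le> interval_sq (?y - w)" by (rule steep_past_point)
  define T D where "T = fst (?y - w)" and "D = norm (snd (?y - w))"
  have TD: "0 \<le> D" "D + \<epsilon> * D \<le> T" using w(2) by (auto simp: T_def D_def algebra_simps)
  then have "D \<le> T" using eps_pos mult_nonneg_nonneg[of \<epsilon> D] by linarith
  have Q: "interval_sq (?y - w) = T\<^sup>2 - D\<^sup>2" by (simp add: interval_sq_def T_def D_def)
  have sm: "sqrt (T\<^sup>2 - D\<^sup>2) \<le> \<tau> ?y"
    using interval_sq_le_tau_sq(1)[OF w(1), of ?y] Q \<open>D \<le> T\<close> by (simp add: T_def D_def)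
  \<comment> \<open>On the steep cone \<open>T \<ge> (1 + \<epsilon>) * D\<close> the ratio of
    \<open>T + D\<close> to \<open>T - D\<close> is largest on the boundary, with value
    \<open>(2 + \<epsilon>) / \<epsilon>\<close>.\<close>
  have "\<epsilon> * (T + D) \<le> (2 + \<epsilon>) * (T - D)" using TD by (simp add: algebra_simps)
  then have "\<epsilon> * (T + D)\<^sup>2 \<le> (2 + \<epsilon>) * (T\<^sup>2 - D\<^sup>2)"
    using TD \<open>D \<le> T\<close> mult_right_mono[of "\<epsilon> * (T + D)" "(2 + \<epsilon>) * (T - D)" "T + D"]
    by (simp add: power2_eq_square algebra_simps)
  then have "(T + D)\<^sup>2 \<le> (2 + \<epsilon>) / \<epsilon> * (T\<^sup>2 - D\<^sup>2)"
    using eps_pos by (simp add: field_simps)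
  then have "T + D \<le> ?\<kappa> * sqrt (T\<^sup>2 - D\<^sup>2)"
    unfolding real_sqrt_mult[symmetric] by (rule real_le_rsqrt)
  also have "\<dots> \<le> ?\<kappa> * \<tau> ?y" using sm eps_pos by (intro mult_left_mono) auto
  finally have TDk: "T + D \<le> ?\<kappa> * \<tau> ?y" .
  have "- (u \<bullet> snd (?y - w)) \<le> D"
    using Cauchy_Schwarz_ineq2[of u "snd (?y - w)"] assms(2) by (simp add: D_def)
  then have "h * (T - u \<bullet> snd (?y - w)) \<le> h * (?\<kappa> * \<tau> ?y)"
    using TDk assms(3) by (intro mult_left_mono) auto
  moreover have "interval_sq (x - w) = interval_sq (?y - w) - 2 * h * (T - u \<bullet> snd (?y - w))"
  proof -
    have "x - w = (?y - w) + (- h) *\<^sub>R (1, u)" by (simp add: algebra_simps zero_prod_def)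
    then have "interval_sq (x - w) = interval_sq ((?y - w) + (- h) *\<^sub>R (1, u))" by (rule arg_cong)
    also have "\<dots> = interval_sq (?y - w) + 2 * (- h) * (T - u \<bullet> snd (?y - w))"
      unfolding T_def by (rule interval_sq_add_null[OF assms(2)])
    finally show ?thesis by simp
  qed
  moreover have "interval_sq (x - w) \<le> (\<tau> x)\<^sup>2"
    using assms w(1) \<open>D \<le> T\<close> by (intro past_of_null_translate[of u h]) (auto simp: T_def D_def)
  ultimately show "interval_sq (?y - z) \<le> (\<tau> x)\<^sup>2 + 2 * h * ?\<kappa> * \<tau> ?y"
    using w(3) by (simp add: algebra_simps)
qed

text \<open>The increment of the squares gives
  \<open>ln (Y / X) \<le> (b - a) * \<kappa> / X\<close>, and \<open>X \<ge> a / \<kappa>\<close>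
  because the ray starts at a point \<open>p\<close> of \<Omega>. The result is the first order
  bound that \<open>ln_ratio_bound_of_infinitesimal\<close> integrates.\<close>

lemma ln_tau_null_growth:
  assumes "p \<in> \<Omega>" "norm u = 1" "0 < a" "a < b"
  shows "ln (\<tau> (p + b *\<^sub>R (1, u))) - ln (\<tau> (p + a *\<^sub>R (1, u))) \<le> (2 + \<epsilon>) / \<epsilon> * ln (b / a)"
proof (rule ln_ratio_bound_of_infinitesimal[OF _ assms(3,4)])
  fix a b :: real assume ab: "0 < a" "a < b"
  define R \<kappa> where "R = (2 + \<epsilon>) / \<epsilon>" and "\<kappa> = sqrt R"
  define X Y where "X = \<tau> (p + a *\<^sub>R (1, u))" and "Y = \<tau> (p + b *\<^sub>R (1, u))"
  have R: "0 < R" using eps_pos by (simp add: R_def)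
  then have \<kappa>: "0 < \<kappa>" "\<kappa>\<^sup>2 = R" by (auto simp: \<kappa>_def)
  have in\<Omega>: "p + c *\<^sub>R (1, u) \<in> \<Omega>" if "0 < c" for c
    using assms that by (intro causal_future_in) auto
  have X: "0 < X" and "0 < Y" using tau_pos in\<Omega> ab by (auto simp: X_def Y_def)
  have "a\<^sup>2 \<le> R * X\<^sup>2"
    using tau_null_translate_ge[OF assms(1,2) ab(1)] eps_pos by (simp add: R_def X_def field_simps)
  then have "a\<^sup>2 \<le> (\<kappa> * X)\<^sup>2" by (simp add: \<kappa> power_mult_distrib)
  then have aX: "a \<le> \<kappa> * X" by (rule power2_le_imp_le) (use \<kappa> X in simp)
  have y: "p + a *\<^sub>R (1, u) + (b - a) *\<^sub>R (1, u) = p + b *\<^sub>R (1, u)"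
    by (simp add: scaleR_diff_left del: scaleR_Pair)
  have inc: "Y\<^sup>2 \<le> X\<^sup>2 + 2 * (b - a) * \<kappa> * Y"
    using tau_sq_null_increment[OF in\<Omega>[OF ab(1)] assms(2), of "b - a"] ab
    unfolding y by (simp add: X_def Y_def \<kappa>_def R_def)
  have "X \<le> Y"
    unfolding X_def Y_def using assms ab in\<Omega>
    by (intro tau_mono) (auto simp flip: scaleR_diff_left)
  then have "ln (Y / X) \<le> (Y / X - 1 / (Y / X)) / 2"
    using X by (intro ln_le_half_diff_inverse) simp
  also have "\<dots> = (Y\<^sup>2 - X\<^sup>2) / (2 * X * Y)"
    using X \<open>0 < Y\<close> by (simp add: field_simps power2_eq_square)
  also have "\<dots> \<le> (2 * (b - a) * \<kappa> * Y) / (2 * X * Y)"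
    using inc X \<open>0 < Y\<close> by (intro divide_right_mono) auto
  also have "\<dots> = (b - a) * \<kappa> / X" using X \<open>0 < Y\<close> by (simp add: divide_simps)
  also have "\<dots> \<le> (b - a) * R / a"
  proof -
    have "\<kappa> * a \<le> \<kappa> * (\<kappa> * X)" using aX \<kappa> by simp
    then have "(b - a) * (\<kappa> * a) \<le> (b - a) * (R * X)"
      using ab \<kappa> by (intro mult_left_mono) (auto simp: power2_eq_square)
    then show ?thesis using X ab by (simp add: divide_simps)
  qed
  also have "\<dots> = R * (b / a - 1)" using ab by (simp add: divide_simps)
  also have "ln (Y / X) = ln Y - ln X" using X \<open>0 < Y\<close> by (simp add: ln_div)
  finally show "ln (\<tau> (p + b *\<^sub>R (1, u))) - ln (\<tau> (p + a *\<^sub>R (1, u))) \<le> (2 + \<epsilon>) / \<epsilon> * (b / a - 1)"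
    by (simp only: X_def Y_def R_def)
qed

section \<open>Comparison of the two kinds of chains\<close>

lemma geodesic_step:
  assumes "projective_lightlike_geodesic \<Omega> \<gamma>" "s \<in> I" "t \<in> I"
  shows "\<bar>ln (\<tau> (\<gamma> t)) - ln (\<tau> (\<gamma> s))\<bar> \<le> (2 + \<epsilon>) / \<epsilon> * rho_I s t"
    and "causally_related minkowski_form (\<gamma> s) (\<gamma> t)"
proof -
  obtain x u a b c d \<eta> where u: "norm u = 1" and det: "0 < a * d - b * c" and \<eta>: "\<eta> = 1 \<or> \<eta> = (-1::real)"
    and pos: "\<And>s. s \<in> I \<Longrightarrow> 0 < c * s + d"
    and \<gamma>: "\<And>s. s \<in> I \<Longrightarrow> \<gamma> s = x + ((a * (\<eta> * s) + b) / (c * (\<eta> * s) + d)) *\<^sub>R (1, u)"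
    using projective_lightlike_geodesic_normal_form[OF assms(1)] by metis
  define h where "h s = (a * s + b) / (c * s + d)" for s
  define g where "g s = x + h s *\<^sub>R (1, u)" for s
  have \<gamma>g: "\<gamma> s = g (\<eta> * s)" if "s \<in> I" for s using \<gamma>[OF that] by (simp add: g_def h_def)
  have \<eta>I: "\<eta> * s \<in> I" if "s \<in> I" for s using \<eta> that by auto
  have g\<Omega>: "g s \<in> \<Omega>" if "s \<in> I" for s
  proof -
    have "g s = \<gamma> (\<eta> * s)" using \<gamma>g[OF \<eta>I[OF that]] \<eta> by auto
    moreover have "\<gamma> ` I \<subseteq> \<Omega>" using assms(1) unfolding projective_lightlike_geodesic_def by blast
    ultimately show ?thesis using \<eta>I[OF that] by auto
  qed
  have inc: "h r < h q" if "r \<in> I" "q \<in> I" "r < q" for r q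
    \<comment> \<open>The pair serves twice: as the fixed points \<open>s\<close>, \<open>t\<close>
      of that lemma and as the points compared.\<close>
    using homography_ln_ratio_le_rho_I(1)[OF det pos that(1,2,3) that(1,2,3)] by (simp add: h_def)
  have causal: "norm (snd (g q - g r)) \<le> fst (g q - g r)" if "r \<in> I" "q \<in> I" "r < q" for r q
    using inc[OF that] u by (simp add: g_def flip: scaleR_diff_left)
  have main: "\<bar>ln (\<tau> (g q)) - ln (\<tau> (g p))\<bar> \<le> (2 + \<epsilon>) / \<epsilon> * rho_I p q"
    if pq: "p \<in> I" "q \<in> I" "p < q" for p q
  proof -
    have "ln (\<tau> (g q)) - ln (\<tau> (g p)) \<le> (2 + \<epsilon>) / \<epsilon> * rho_I p q"
    \<comment> \<open>The growth bound needs a base point in \<Omega>, and the left end of the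
      geodesic may lie on the frontier. So \<open>g r\<close> is the base point, and the Schwarz
      lemma lets \<open>r\<close> tend to the end.\<close>
    proof (rule homography_ln_ratio_le_rho_I(2)[OF det pos pq, folded h_def])
      fix r assume r: "r \<in> I" "r < p"
      have "g q = g r + (h q - h r) *\<^sub>R (1, u)" "g p = g r + (h p - h r) *\<^sub>R (1, u)"
        by (simp_all add: g_def algebra_simps)
      then show "ln (\<tau> (g q)) - ln (\<tau> (g p)) \<le> (2 + \<epsilon>) / \<epsilon> * ln ((h q - h r) / (h p - h r))"
        using ln_tau_null_growth[OF g\<Omega>[OF r(1)] u, of "h p - h r" "h q - h r"] inc[of r p] inc[of p q] r pq
        by simp
    qed (use eps_pos in \<open>auto intro!: divide_nonneg_pos\<close>)
    moreover have "ln (\<tau> (g p)) \<le> ln (\<tau> (g q))"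
      using tau_mono[OF g\<Omega>[OF pq(1)] causal[OF pq]] tau_pos g\<Omega> pq by (subst ln_le_cancel_iff) auto
    ultimately show ?thesis by simp
  qed
  have main': "\<bar>ln (\<tau> (g q)) - ln (\<tau> (g p))\<bar> \<le> (2 + \<epsilon>) / \<epsilon> * rho_I p q"
    if pq: "p \<in> I" "q \<in> I" for p q
  proof (cases p q rule: linorder_cases)
    case greater
    then show ?thesis using main[of q p] pq by (simp add: rho_I_commute abs_minus_commute)
  qed (use main pq eps_pos rho_I_nonneg in auto)
  have "rho_I (\<eta> * s) (\<eta> * t) = rho_I s t" using \<eta> rho_I_uminus[OF assms(2,3)] by auto
  then show "\<bar>ln (\<tau> (\<gamma> t)) - ln (\<tau> (\<gamma> s))\<bar> \<le> (2 + \<epsilon>) / \<epsilon> * rho_I s t"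
    using main'[OF \<eta>I[OF assms(2)] \<eta>I[OF assms(3)]] \<gamma>g assms by simp
  have "causally_related minkowski_form (g p) (g q)" if "p \<in> I" "q \<in> I" for p q
    using causal[of p q] causal[of q p] that
    by (cases p q rule: linorder_cases) (auto simp: causally_related_def causal_le_minkowski_iff)
  then show "causally_related minkowski_form (\<gamma> s) (\<gamma> t)"
    using \<gamma>g \<eta>I assms by simp
qed

text \<open>A causal vector is the sum of two null vectors.\<close>

lemma markowitz_sums_causal:
  assumes "x \<in> \<Omega>" "y \<in> \<Omega>" "causally_related minkowski_form x y"
    and r: "r \<in> markowitz_sums \<Omega> z x"
  obtains r' where "r' \<in> markowitz_sums \<Omega> z y" "r' \<le> r + 2 * \<bar>ln (\<tau> y) - ln (\<tau> x)\<bar>"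
proof -
  have key: "\<exists>\<gamma> \<gamma>' s t s' t'. projective_lightlike_geodesic \<Omega> \<gamma> \<and> projective_lightlike_geodesic \<Omega> \<gamma>' \<and>
      s \<in> I \<and> t \<in> I \<and> s' \<in> I \<and> t' \<in> I \<and> \<gamma> s = a \<and> \<gamma> t = \<gamma>' s' \<and> \<gamma>' t' = b \<and>
      rho_I s t + rho_I s' t' \<le> 2 * \<bar>ln (\<tau> b) - ln (\<tau> a)\<bar>"
    if ab: "a \<in> \<Omega>" "norm (snd (b - a)) \<le> fst (b - a)" for a b
  proof -
    define T D where "T = fst (b - a)" and "D = norm (snd (b - a))"
    obtain u where u: "norm u = 1" "snd (b - a) = D *\<^sub>R u"
      unfolding D_def by (rule unit_vector_along)
    \<comment> \<open>The corner of the null path from \<open>a\<close> to \<open>b\<close>: first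
      \<open>(T + D) / 2\<close> along \<open>(1, u)\<close>, then \<open>(T - D) / 2\<close> along
      \<open>(1, - u)\<close>.\<close>
    define c where "c = a + ((T + D) / 2) *\<^sub>R (1, u)"
    have TD: "0 \<le> D" "D \<le> T" using ab by (auto simp: T_def D_def)
    have "b - a = (T, D *\<^sub>R u)" using u by (simp add: prod_eq_iff T_def)
    also have "\<dots> = ((T + D) / 2) *\<^sub>R (1, u) + ((T - D) / 2) *\<^sub>R (1, - u)"
      by (simp add: field_simps flip: scaleR_diff_left)
    finally have b: "b = c + ((T - D) / 2) *\<^sub>R (1, - u)"
      by (simp add: c_def algebra_simps del: scaleR_Pair)
    have c: "c \<in> \<Omega>"
      unfolding c_def using u TD by (intro causal_future_in[OF ab(1)]) auto
    obtain \<gamma> s t where 1: "projective_lightlike_geodesic \<Omega> \<gamma>" "s \<in> I" "t \<in> I"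
        "\<gamma> s = a" "\<gamma> t = c" "rho_I s t \<le> 2 * (ln (\<tau> c) - ln (\<tau> a))"
      by (rule null_segment_geodesic[OF ab(1) u(1), of "(T + D) / 2", folded c_def]) (use TD in auto)
    obtain \<gamma>' s' t' where 2: "projective_lightlike_geodesic \<Omega> \<gamma>'" "s' \<in> I" "t' \<in> I"
        "\<gamma>' s' = c" "\<gamma>' t' = b" "rho_I s' t' \<le> 2 * (ln (\<tau> b) - ln (\<tau> c))"
      by (rule null_segment_geodesic[OF c, of "- u" "(T - D) / 2", folded b]) (use TD u in auto)
    \<comment> \<open>Both pieces are future directed, so their bounds telescope at
      \<open>c\<close>.\<close>
    have "rho_I s t + rho_I s' t' \<le> 2 * (ln (\<tau> b) - ln (\<tau> a))" using 1(6) 2(6) by simp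
    also have "\<dots> \<le> 2 * \<bar>ln (\<tau> b) - ln (\<tau> a)\<bar>" 
      by (intro mult_left_mono abs_ge_self) simp
    finally have "rho_I s t + rho_I s' t' \<le> 2 * \<bar>ln (\<tau> b) - ln (\<tau> a)\<bar>" .
    with 1(1-5) 2(1-5) show ?thesis
      by (intro exI[of _ \<gamma>] exI[of _ \<gamma>'] exI[of _ s] exI[of _ t] exI[of _ s'] exI[of _ t']) simp
  qed
  consider "causal_le minkowski_form x y" | "causal_le minkowski_form y x"
    using assms(3) by (auto simp: causally_related_def)
  then show thesis
  proof cases
    case 1
    then obtain \<gamma> \<gamma>' s t s' t' where h: "projective_lightlike_geodesic \<Omega> \<gamma>"
      "projective_lightlike_geodesic \<Omega> \<gamma>'" "s \<in> I" "t \<in> I" "s' \<in> I" "t' \<in> I"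
      "\<gamma> s = x" "\<gamma> t = \<gamma>' s'" "\<gamma>' t' = y"
      "rho_I s t + rho_I s' t' \<le> 2 * \<bar>ln (\<tau> y) - ln (\<tau> x)\<bar>"
      using key[OF assms(1), of y] unfolding causal_le_minkowski_iff by metis
    have "r + rho_I s t \<in> markowitz_sums \<Omega> z (\<gamma>' s')"
      using markowitz_sums_snoc[of r \<Omega> z \<gamma> s t] r h by simp
    then have "r + rho_I s t + rho_I s' t' \<in> markowitz_sums \<Omega> z y"
      using markowitz_sums_snoc[of _ \<Omega> z \<gamma>' s' t'] h by metis
    then show ?thesis by (rule that) (use h(10) in \<open>simp add: add.assoc\<close>)
  next
    case 2
    then obtain \<gamma> \<gamma>' s t s' t' where h: "projective_lightlike_geodesic \<Omega> \<gamma>"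
      "projective_lightlike_geodesic \<Omega> \<gamma>'" "s \<in> I" "t \<in> I" "s' \<in> I" "t' \<in> I"
      "\<gamma> s = y" "\<gamma> t = \<gamma>' s'" "\<gamma>' t' = x"
      "rho_I s t + rho_I s' t' \<le> 2 * \<bar>ln (\<tau> x) - ln (\<tau> y)\<bar>"
      using key[OF assms(2), of x] unfolding causal_le_minkowski_iff by metis
    \<comment> \<open>Here \<open>y\<close> precedes \<open>x\<close>: the two geodesics are
      traversed backwards, in the opposite order.\<close>
    have "r + rho_I t' s' \<in> markowitz_sums \<Omega> z (\<gamma> t)"
      using markowitz_sums_snoc[of r \<Omega> z \<gamma>' t' s'] r h by simp
    then have "r + rho_I t' s' + rho_I t s \<in> markowitz_sums \<Omega> z y"
      using markowitz_sums_snoc[of _ \<Omega> z \<gamma> t s] h by metis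
    then show ?thesis
      by (rule that) (use h(10) rho_I_commute[OF h(3,4)] rho_I_commute[OF h(5,6)]
        in \<open>simp add: add.assoc add.commute abs_minus_commute\<close>)
  qed
qed

definition null_chain :: "nat \<Rightarrow> (nat \<Rightarrow> 'n minkowski) \<Rightarrow> 'n minkowski \<Rightarrow> 'n minkowski \<Rightarrow> bool" where
  "null_chain m p x y \<longleftrightarrow> 1 \<le> m \<and> p 1 = x \<and> p m = y \<and> (\<forall>k\<in>{1..m}. p k \<in> \<Omega>) \<and>
      (\<forall>k\<in>{1..<m}. causally_related minkowski_form (p k) (p (k + 1)))"

definition null_sums :: "'n minkowski \<Rightarrow> 'n minkowski \<Rightarrow> real set" where
  "null_sums x y =
    {(\<Sum>k\<in>{1..<m}. \<bar>ln (\<tau> (p (k + 1))) - ln (\<tau> (p k))\<bar>) | m p. null_chain m p x y}"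

lemma null_distance_eq: "null_distance \<Omega> (\<lambda>z. ln (\<tau> z)) x y = Inf (null_sums x y)"
  unfolding null_distance_def null_sums_def null_chain_def ..

text \<open>A point \<open>z\<close> high enough above \<open>x\<close> is in the causal future of
  both points, so \<open>x\<close>, \<open>z\<close>, \<open>y\<close> is a chain.\<close>

lemma null_sums_nonempty:
  assumes "x \<in> \<Omega>" "y \<in> \<Omega>"
  shows "null_sums x y \<noteq> {}"
proof -
  define z where "z = x + (norm (snd (x - y)) + \<bar>fst (y - x)\<bar>) *\<^sub>R (1, 0)"
  define p :: "nat \<Rightarrow> 'n minkowski" where "p k = (if k = 1 then x else if k = 2 then z else y)" for k
  have "causal_le minkowski_form x z" "causal_le minkowski_form y z"
    by (auto simp: causal_le_minkowski_iff z_def)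
  moreover have "z \<in> \<Omega>" unfolding z_def by (intro causal_future_in assms) simp
  moreover have "{1..<3} = {1, 2 :: nat}" by auto
  ultimately have "(\<Sum>k\<in>{1..<3}. \<bar>ln (\<tau> (p (k + 1))) - ln (\<tau> (p k))\<bar>) \<in> null_sums x y"
    unfolding null_sums_def using assms
    by (intro CollectI exI[of _ 3] exI[of _ p]) (auto simp: null_chain_def p_def causally_related_def)
  then show ?thesis by blast
qed

lemma markowitz_sums_le_null_sums:
  assumes "S \<in> null_sums x y"
  obtains r where "r \<in> markowitz_sums \<Omega> x y" "r \<le> 2 * S"
proof -
  obtain m p where S: "S = (\<Sum>k\<in>{1..<m}. \<bar>ln (\<tau> (p (k + 1))) - ln (\<tau> (p k))\<bar>)"
    and chain: "null_chain m p x y"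
    using assms unfolding null_sums_def by auto
  have m: "1 \<le> m" "p 1 = x" "p m = y"
    using chain by (simp_all add: null_chain_def)
  have p\<Omega>: "p k \<in> \<Omega>" if "k \<in> {1..m}" for k
    using chain that by (simp add: null_chain_def)
  have rel: "causally_related minkowski_form (p k) (p (k + 1))" if "k \<in> {1..<m}" for k
    using chain that by (simp add: null_chain_def)
  have "\<exists>r\<in>markowitz_sums \<Omega> x (p j).
      r \<le> 2 * (\<Sum>k\<in>{1..<j}. \<bar>ln (\<tau> (p (k + 1))) - ln (\<tau> (p k))\<bar>)"
    if "1 \<le> j" "j \<le> m" for j
    using that
  proof (induction j rule: dec_induct)
    case base
    have x: "x \<in> \<Omega>" using p\<Omega>[of 1] m by simp
    obtain u :: "real ^ 'n" where u: "norm u = 1" using vector_choose_size[of 1] by auto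
    \<comment> \<open>The null sum is empty here, but a Markowitz chain needs at least one geodesic;
      any geodesic through \<open>x\<close> with equal parameters costs 0.\<close>
    obtain \<gamma> s t where g: "projective_lightlike_geodesic \<Omega> \<gamma>" "s \<in> I" "\<gamma> s = x"
      by (rule null_segment_geodesic[OF x u order_refl])
    then have "rho_I s s \<in> markowitz_sums \<Omega> x x"
      using markowitz_sums_single[of \<Omega> \<gamma> s s] by simp
    moreover have "rho_I s s = 0" using g(2) by (simp add: rho_I_eq)
    ultimately show ?case using m by auto
  next
    case (step j)
    then obtain r where r: "r \<in> markowitz_sums \<Omega> x (p j)"
      "r \<le> 2 * (\<Sum>k\<in>{1..<j}. \<bar>ln (\<tau> (p (k + 1))) - ln (\<tau> (p k))\<bar>)" by auto
    obtain r' where "r' \<in> markowitz_sums \<Omega> x (p (j + 1))"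
      "r' \<le> r + 2 * \<bar>ln (\<tau> (p (j + 1))) - ln (\<tau> (p j))\<bar>"
      by (rule markowitz_sums_causal[OF p\<Omega> p\<Omega> rel r(1)]) (use step in auto)
    then show ?case using r(2) step by (intro bexI[of _ r']) auto
  qed
  from this[of m] show thesis using m S that by auto
qed

lemma null_sums_le_markowitz_sums:
  assumes "r \<in> markowitz_sums \<Omega> x y"
  obtains S where "S \<in> null_sums x y" "S \<le> (2 + \<epsilon>) / \<epsilon> * r"
proof -
  obtain m \<gamma> s t where r: "r = (\<Sum>k\<in>{1..m}. rho_I (s k) (t k))"
    and chain: "markowitz_chain \<Omega> m \<gamma> s t x y"
    using assms unfolding markowitz_sums_def by auto
  have m: "1 \<le> m" and ends: "\<gamma> 1 (s 1) = x" "\<gamma> m (t m) = y"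
    using chain by (simp_all add: markowitz_chain_def)
  have g: "projective_lightlike_geodesic \<Omega> (\<gamma> k) \<and> s k \<in> I \<and> t k \<in> I" if "k \<in> {1..m}" for k
    using chain that by (simp add: markowitz_chain_def)
  have link: "\<gamma> k (t k) = \<gamma> (k + 1) (s (k + 1))" if "k \<in> {1..<m}" for k
    using chain that by (simp add: markowitz_chain_def)
  \<comment> \<open>The starting points of the \<open>m\<close> geodesics followed by
    \<open>y\<close>: a null chain with \<open>m + 1\<close> points has \<open>m\<close>
    links.\<close>
  define p where "p k = (if k \<le> m then \<gamma> k (s k) else y)" for k
  have p1: "p k = \<gamma> k (s k)" if "k \<in> {1..m}" for k
    using that by (simp add: p_def)
  have p2: "p (k + 1) = \<gamma> k (t k)" if "k \<in> {1..m}" for k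
    using that link[of k] ends by (cases "k = m") (auto simp: p_def)
  note p = p1 p2
  have in\<Omega>: "\<gamma> k q \<in> \<Omega>" if "k \<in> {1..m}" "q \<in> I" for k q
    using g[OF that(1)] that(2) unfolding projective_lightlike_geodesic_def by blast
  have "p k \<in> \<Omega>" if "k \<in> {1..m + 1}" for k
    using that in\<Omega>[of k "s k"] in\<Omega>[of m "t m"] g[of k] g[of m] m ends by (cases "k \<le> m") (auto simp: p_def)
  then have "(\<Sum>k\<in>{1..<m + 1}. \<bar>ln (\<tau> (p (k + 1))) - ln (\<tau> (p k))\<bar>) \<in> null_sums x y"
    unfolding null_sums_def null_chain_def using m ends geodesic_step(2) g p
    by (intro CollectI exI[of _ "m + 1"] exI[of _ p]) (auto simp: p_def)
  moreover have "(\<Sum>k\<in>{1..<m + 1}. \<bar>ln (\<tau> (p (k + 1))) - ln (\<tau> (p k))\<bar>)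
      \<le> (\<Sum>k\<in>{1..<m + 1}. (2 + \<epsilon>) / \<epsilon> * rho_I (s k) (t k))"
  proof (rule sum_mono)
    fix k assume "k \<in> {1..<m + 1}"
    then have k: "k \<in> {1..m}" by auto
    show "\<bar>ln (\<tau> (p (k + 1))) - ln (\<tau> (p k))\<bar> \<le> (2 + \<epsilon>) / \<epsilon> * rho_I (s k) (t k)"
      unfolding p[OF k] using geodesic_step(1) g[OF k] by blast
  qed
  moreover have "{1..<m + 1} = {1..m}" by auto
  then have "(\<Sum>k\<in>{1..<m + 1}. (2 + \<epsilon>) / \<epsilon> * rho_I (s k) (t k)) = (2 + \<epsilon>) / \<epsilon> * r"
    unfolding r sum_distrib_left by simp
  ultimately show thesis using that by simp
qed

section \<open>Passage to the infima and comparison of constants\<close>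

lemma markowitz_le_null:
  assumes "x \<in> \<Omega>" "y \<in> \<Omega>"
  shows "markowitz_dist \<Omega> x y \<le> 2 * null_distance \<Omega> (\<lambda>z. ln (\<tau> z)) x y"
proof -
  have "bdd_below (markowitz_sums \<Omega> x y)"
    by (intro bdd_belowI[of _ 0]) (auto simp: markowitz_sums_def intro!: sum_nonneg rho_I_nonneg)
  then have "markowitz_dist \<Omega> x y / 2 \<le> S" if "S \<in> null_sums x y" for S
    unfolding markowitz_dist_eq
    using markowitz_sums_le_null_sums[OF that] cInf_lower by (smt (verit) field_sum_of_halves)
  then have "markowitz_dist \<Omega> x y / 2 \<le> null_distance \<Omega> (\<lambda>z. ln (\<tau> z)) x y"
    unfolding null_distance_eq by (intro cInf_greatest null_sums_nonempty assms)
  then show ?thesis by simp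
qed

lemma null_le_markowitz:
  assumes "x \<in> \<Omega>" "y \<in> \<Omega>"
  shows "\<epsilon> / (2 + \<epsilon>) * null_distance \<Omega> (\<lambda>z. ln (\<tau> z)) x y \<le> markowitz_dist \<Omega> x y"
proof -
  obtain S where "S \<in> null_sums x y" using null_sums_nonempty[OF assms] by blast
  \<comment> \<open>The other comparison supplies a Markowitz chain, without which the infimum would
    carry no information.\<close>
  then have ne: "markowitz_sums \<Omega> x y \<noteq> {}" using markowitz_sums_le_null_sums by blast
  have bdd: "bdd_below (null_sums x y)"
    by (intro bdd_belowI[of _ 0]) (auto simp: null_sums_def intro!: sum_nonneg)
  show ?thesis
    unfolding markowitz_dist_eq null_distance_eq
  proof (rule cInf_greatest[OF ne])
    fix r assume "r \<in> markowitz_sums \<Omega> x y"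
    then obtain S where "S \<in> null_sums x y" "S \<le> (2 + \<epsilon>) / \<epsilon> * r"
      by (rule null_sums_le_markowitz_sums)
    then have "Inf (null_sums x y) \<le> (2 + \<epsilon>) / \<epsilon> * r"
      using cInf_lower[OF _ bdd] order_trans by blast
    then show "\<epsilon> / (2 + \<epsilon>) * Inf (null_sums x y) \<le> r"
      using eps_pos by (simp add: field_simps)
  qed
qed

lemma null_distance_nonneg:
  assumes "x \<in> \<Omega>" "y \<in> \<Omega>"
  shows "0 \<le> null_distance \<Omega> (\<lambda>z. ln (\<tau> z)) x y"
  unfolding null_distance_eq
  by (rule cInf_greatest[OF null_sums_nonempty[OF assms]]) (auto simp: null_sums_def intro!: sum_nonneg)

end

theorem theorem6p7:
  fixes \<epsilon> :: real and \<Omega> :: "(real \<times> (real ^ 'n::finite)) set"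
  assumes "\<epsilon> > 0"
    and "domain \<Omega>"
    and "future_complete \<Omega>"
    and "stably_acausal \<epsilon> (frontier \<Omega>)"
  shows "\<forall>x\<in>\<Omega>. \<forall>y\<in>\<Omega>.
    \<epsilon> / sqrt (2 + 2 * (1 + \<epsilon>)\<^sup>2) * null_distance \<Omega> (\<lambda>z. ln (cosmological_time \<Omega> z)) x y - c_eps \<epsilon>
      \<le> markowitz_dist \<Omega> x y \<and>
    markowitz_dist \<Omega> x y \<le> 2 * null_distance \<Omega> (\<lambda>z. ln (cosmological_time \<Omega> z)) x y"
proof (intro ballI conjI)
  interpret stably_acausal_domain \<epsilon> \<Omega>
    using assms by unfold_locales
  fix x y assume xy: "x \<in> \<Omega>" "y \<in> \<Omega>"
  let ?d = "null_distance \<Omega> (\<lambda>z. ln (cosmological_time \<Omega> z)) x y"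
  \<comment> \<open>The constants differ only by the square \<open>\<epsilon>\<^sup>2\<close> under
    the root; nonnegativity of the null distance then allows the smaller factor.\<close>
  have "(2 + \<epsilon>)\<^sup>2 + \<epsilon>\<^sup>2 = 2 + 2 * (1 + \<epsilon>)\<^sup>2"
    by (simp add: power2_eq_square algebra_simps)
  then have "(2 + \<epsilon>)\<^sup>2 \<le> 2 + 2 * (1 + \<epsilon>)\<^sup>2"
    using zero_le_power2[of \<epsilon>] by linarith
  then have "2 + \<epsilon> \<le> sqrt (2 + 2 * (1 + \<epsilon>)\<^sup>2)" by (rule real_le_rsqrt)
  then have "\<epsilon> / sqrt (2 + 2 * (1 + \<epsilon>)\<^sup>2) \<le> \<epsilon> / (2 + \<epsilon>)"
    using assms(1) by (intro frac_le) auto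
  then have "\<epsilon> / sqrt (2 + 2 * (1 + \<epsilon>)\<^sup>2) * ?d \<le> \<epsilon> / (2 + \<epsilon>) * ?d"
    using null_distance_nonneg[OF xy] by (rule mult_right_mono)
  also have "\<dots> \<le> markowitz_dist \<Omega> x y" by (rule null_le_markowitz[OF xy])
  finally have "\<epsilon> / sqrt (2 + 2 * (1 + \<epsilon>)\<^sup>2) * ?d \<le> markowitz_dist \<Omega> x y" .
  moreover have "0 \<le> c_eps \<epsilon>"
  proof -
    have "1 < (1 + \<epsilon>)\<^sup>2" using assms(1) by (simp add: one_less_power)
    then have "1 \<le> ((1 + \<epsilon>)\<^sup>2 + 1) / ((1 + \<epsilon>)\<^sup>2 - 1)" by simp
    then show ?thesis
      unfolding c_eps_def using assms(1) by (intro mult_nonneg_nonneg ln_ge_zero) auto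
  qed
  ultimately show "\<epsilon> / sqrt (2 + 2 * (1 + \<epsilon>)\<^sup>2) * ?d - c_eps \<epsilon> \<le> markowitz_dist \<Omega> x y"
    by simp
  show "markowitz_dist \<Omega> x y \<le> 2 * ?d"
    by (rule markowitz_le_null[OF xy])
qed

end
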